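(* Let $r>1$ be an integer, let $k\geq 1$ be a natural number, and let $m,n\ge 0$ be integers. Let $D^m\subset\mathbb{R}^m$ be the open unit disc. For $1\le i\le k$ let $0_i$ denote the center of the $i$-th copy of $D^m$ in $\coprod_k D^m$. Then the map $$\operatorname{ev}\colon \operatorname{rImm}\Big(\coprod_k D^m,\mathbb{R}^n\Big)\to \operatorname{rConf}(k,\mathbb{R}^n)\times \operatorname{Linj}(\mathbb{R}^m,\mathbb{R}^n)^k,\qquad f\mapsto \big((f(0_1),\dots,f(0_k)),(f'(0_1),\dots,f'(0_k))\big),$$ is a weak homotopy equivalence.
   Context: $\coprod_k D^m$ is the disjoint union of $k$ copies of the open unit disc $D^m$. For a smooth map $f\colon\coprod_k D^m\to\mathbb{R}^n$ and a point $x$, $f'(x)\colon\mathbb{R}^m\to\mathbb{R}^n$ is the Fréchet derivative of $f$ at $x$ (each copy of $D^m$ being regarded as an open subset of $\mathbb{R}^m$). For a manifold $M$, an $r$-immersion $M\to\mathbb{R}^n$ is a smooth immersion such that the preimage of every point of $\mathbb{R}^n$ contains fewer than $r$ points. $\operatorname{rImm}(M,\mathbb{R}^n)$ is the space of all $r$-immersions, topologized as a subspace of the space $C^\infty(M,\mathbb{R}^n)$ of smooth maps with the compact-open $C^\infty$-topology (weak Whitney topology: uniform convergence of the function and of all its derivatives on compact subsets). $\operatorname{rConf}(k,\mathbb{R}^n)\subset(\mathbb{R}^n)^k$ is the $r$-configuration space (non-$r$-equal configuration space): the subspace of all $(x_1,\dots,x_k)$ such that there are no indices $1\le i_1<\cdots<i_r\le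 k$ with $x_{i_1}=\cdots=x_{i_r}$. $\operatorname{Linj}(\mathbb{R}^m,\mathbb{R}^n)$ is the space of injective linear maps $\mathbb{R}^m\to\mathbb{R}^n$, with the subspace topology from the finite-dimensional vector space of all linear maps. *)

theory Defs
  imports "HOL-Analysis.Analysis"
begin

section \<open>Euclidean spaces, including the zero-dimensional one\<close>

text \<open>
  The types \<open>real ^ 'n\<close> and the class \<^class>\<open>euclidean_space\<close> exclude
  dimension zero. The following class consists of the finite-dimensional real inner
  product spaces, i.e. of the spaces isometric to $\mathbb{R}^m$ for some $m \ge 0$; its
  instances include \<^typ>\<open>unit\<close> (dimension $0$) and all Euclidean spaces.
\<close>

class fin_dim_inner = real_inner +
  assumes finite_spanning: "\<exists>B. finite B \<and> (\<forall>x. \<exists>c. x = (\<Sum>b\<in>B. c b *\<^sub>R b))"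

subclass (in euclidean_space) fin_dim_inner
proof
  show "\<exists>B. finite B \<and> (\<forall>x. \<exists>c. x = (\<Sum>b\<in>B. c b *\<^sub>R b))"
    using euclidean_representation[symmetric] by (intro exI[of _ Basis] conjI finite_Basis allI exI)
qed

instantiation unit :: real_inner
begin

definition zero_unit :: unit where "zero_unit = ()"
definition plus_unit :: "unit \<Rightarrow> unit \<Rightarrow> unit" where "plus_unit _ _ = ()"
definition minus_unit :: "unit \<Rightarrow> unit \<Rightarrow> unit" where "minus_unit _ _ = ()"
definition uminus_unit :: "unit \<Rightarrow> unit" where "uminus_unit _ = ()"
definition scaleR_unit :: "real \<Rightarrow> unit \<Rightarrow> unit" where "scaleR_unit _ _ = ()"
definition inner_unit :: "unit \<Rightarrow> unit \<Rightarrow> real" where "inner_unit _ _ = 0"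
definition norm_unit :: "unit \<Rightarrow> real" where "norm_unit _ = 0"
definition sgn_unit :: "unit \<Rightarrow> unit" where "sgn_unit _ = ()"
definition dist_unit :: "unit \<Rightarrow> unit \<Rightarrow> real" where "dist_unit _ _ = 0"
definition uniformity_unit :: "(unit \<times> unit) filter"
  where "uniformity_unit = (INF e\<in>{0<..}. principal {(x, y). dist x y < e})"
definition open_unit :: "unit set \<Rightarrow> bool"
  where "open_unit U \<longleftrightarrow> (\<forall>x\<in>U. eventually (\<lambda>(x', y). x' = x \<longrightarrow> y \<in> U) uniformity)"

instance
  by standard (simp_all add: inner_unit_def norm_unit_def dist_unit_def
       uniformity_unit_def open_unit_def)

end

instance unit :: fin_dim_inner
proof
  show "\<exists>B :: unit set. finite B \<and> (\<forall>x. \<exists>c. x = (\<Sum>b\<in>B. c b *\<^sub>R b))"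
    by (rule exI[of _ "{}"]) simp
qed

lemma dim_unit: "dim (UNIV :: unit set) = 0"
proof -
  have "(UNIV :: unit set) = {0}" by auto
  then show ?thesis
    using real_vector.dim_eq_card[of "{}" "UNIV :: unit set"] independent_empty by simp
qed


section \<open>Weak homotopy equivalences\<close>

definition cube :: "nat \<Rightarrow> (nat \<Rightarrow> real) topology"
  where "cube q = product_topology (\<lambda>_. top_of_set {0..1}) {..<q}"

definition cube_boundary :: "nat \<Rightarrow> (nat \<Rightarrow> real) set"
  where "cube_boundary q = {t \<in> topspace (cube q). \<exists>j<q. t j = 0 \<or> t j = 1}"

text \<open>
  Representatives are total functions; those that agree on the cube are homotopic
  relative to its boundary, so values outside the cube do not affect the classes.
\<close>

definition spheroids :: "nat \<Rightarrow> 'a topology \<Rightarrow> 'a \<Rightarrow> ((nat \<Rightarrow> real) \<Rightarrow> 'a) set"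
  where "spheroids q X x =
    {a. continuous_map (cube q) X a \<and> a ` cube_boundary q \<subseteq> {x}}"

definition spheroid_homotopy ::
    "nat \<Rightarrow> 'a topology \<Rightarrow> 'a \<Rightarrow> (((nat \<Rightarrow> real) \<Rightarrow> 'a) \<times> ((nat \<Rightarrow> real) \<Rightarrow> 'a)) set"
  where "spheroid_homotopy q X x =
    {(a, b). homotopic_with (\<lambda>h. h ` cube_boundary q \<subseteq> {x}) (cube q) X a b}"

definition homotopy_group :: "nat \<Rightarrow> 'a topology \<Rightarrow> 'a \<Rightarrow> ((nat \<Rightarrow> real) \<Rightarrow> 'a) set set"
  where "homotopy_group q X x = spheroids q X x // spheroid_homotopy q X x"

definition homotopy_group_map ::
    "nat \<Rightarrow> 'b topology \<Rightarrow> 'b \<Rightarrow> ('a \<Rightarrow> 'b) \<Rightarrow>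
      ((nat \<Rightarrow> real) \<Rightarrow> 'a) set \<Rightarrow> ((nat \<Rightarrow> real) \<Rightarrow> 'b) set"
  where "homotopy_group_map q Y y \<phi> C = spheroid_homotopy q Y y `` ((\<lambda>a. \<phi> \<circ> a) ` C)"

definition path_components_map ::
    "'b topology \<Rightarrow> ('a \<Rightarrow> 'b) \<Rightarrow> 'a set \<Rightarrow> 'b set"
  where "path_components_map Y \<phi> C = (\<Union>x\<in>C. path_component_of_set Y (\<phi> x))"

text \<open>
  The map induced on homotopy groups is always a group homomorphism, so being an
  isomorphism means being bijective. Path components are treated separately, without
  base point, so that the empty space needs no exception.
\<close>

definition weak_homotopy_equivalence ::
    "'a topology \<Rightarrow> 'b topology \<Rightarrow> ('a \<Rightarrow> 'b) \<Rightarrow> bool"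
  where "weak_homotopy_equivalence X Y \<phi> \<longleftrightarrow>
    continuous_map X Y \<phi> \<and>
    bij_betw (path_components_map Y \<phi>) (path_components_of X) (path_components_of Y) \<and>
    (\<forall>q\<ge>1. \<forall>x\<in>topspace X.
      bij_betw (homotopy_group_map q Y (\<phi> x) \<phi>)
        (homotopy_group q X x) (homotopy_group q Y (\<phi> x)))"


section \<open>Smooth maps\<close>

text \<open>
  \<open>iter_deriv [v\<^sub>1, \<dots>, v\<^sub>j] f x\<close> is the $j$-th Frechet derivative of \<open>f\<close> at \<open>x\<close> evaluated at
  \<open>v\<^sub>1, \<dots>, v\<^sub>j\<close>. A map is smooth on an open set if all these iterated derivatives exist
  there; their continuity then follows from the existence of the next derivative.
\<close>

primrec iter_deriv ::
    "'a::real_normed_vector list \<Rightarrow> ('a \<Rightarrow> 'b::real_normed_vector) \<Rightarrow> 'a \<Rightarrow> 'b"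
  where
    "iter_deriv [] f = f"
  | "iter_deriv (v # vs) f = (\<lambda>x. frechet_derivative (iter_deriv vs f) (at x) v)"

definition smooth_on :: "'a::real_normed_vector set \<Rightarrow> ('a \<Rightarrow> 'b::real_normed_vector) \<Rightarrow> bool"
  where "smooth_on U f \<longleftrightarrow> (\<forall>vs. \<forall>x\<in>U. iter_deriv vs f differentiable (at x))"


section \<open>Smooth maps and r-immersions on a disjoint union of discs\<close>

text \<open>
  The point \<open>x\<close> of the \<open>i\<close>-th disc is represented by the pair \<open>(i, x)\<close>. Maps on the
  disjoint union are represented by functions that are \<^const>\<open>undefined\<close> elsewhere.
\<close>

definition discs :: "nat \<Rightarrow> (nat \<times> 'a::real_normed_vector) set"
  where "discs k = {1..k} \<times> ball 0 1"

definition smooth_maps ::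
    "nat \<Rightarrow> (nat \<times> 'a::real_normed_vector \<Rightarrow> 'b::real_normed_vector) set"
  where "smooth_maps k =
    {f \<in> extensional (discs k). \<forall>i\<in>{1..k}. smooth_on (ball 0 1) (\<lambda>x. f (i, x))}"

text \<open>
  The compact-open $C^\infty$-topology, generated by the balls of the seminorms
  $\sup_K \|D^j f(v_1, \dots, v_j)\|$ with \<open>K\<close> compact.
\<close>

definition smooth_nbhd ::
    "nat \<Rightarrow> (nat \<times> 'a::real_normed_vector \<Rightarrow> 'b::real_normed_vector) \<Rightarrow>
      (nat \<times> 'a) set \<Rightarrow> 'a list \<Rightarrow> real \<Rightarrow> (nat \<times> 'a \<Rightarrow> 'b) set"
  where "smooth_nbhd k f K vs \<epsilon> =
    {g \<in> smooth_maps k. \<forall>(i, x)\<in>K.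
      norm (iter_deriv vs (\<lambda>y. g (i, y)) x - iter_deriv vs (\<lambda>y. f (i, y)) x) < \<epsilon>}"

definition smooth_topology ::
    "nat \<Rightarrow> (nat \<times> 'a::real_normed_vector \<Rightarrow> 'b::real_normed_vector) topology"
  where "smooth_topology k = topology_generated_by
    {smooth_nbhd k f K vs \<epsilon> | f K vs \<epsilon>.
      f \<in> smooth_maps k \<and> compact K \<and> K \<subseteq> discs k \<and> 0 < \<epsilon>}"

lemma topspace_smooth_topology:
  "topspace (smooth_topology k :: (nat \<times> 'a::real_normed_vector \<Rightarrow> 'b::real_normed_vector) topology)
    = smooth_maps k" (is "?T = ?S")
proof
  show "?T \<subseteq> ?S"
    unfolding smooth_topology_def topology_generated_by_topspace smooth_nbhd_def by blast
  show "?S \<subseteq> ?T"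
  proof
    fix f :: "nat \<times> 'a \<Rightarrow> 'b"
    assume f: "f \<in> smooth_maps k"
    have "f \<in> smooth_nbhd k f {} [] 1"
      using f by (simp add: smooth_nbhd_def)
    moreover have "\<exists>g K vs \<epsilon>. smooth_nbhd k f {} [] 1 = smooth_nbhd k g K vs \<epsilon> \<and>
        g \<in> smooth_maps k \<and> compact K \<and> K \<subseteq> discs k \<and> 0 < \<epsilon>"
      using f by (intro exI[of _ f] exI[of _ "{}"] exI[of _ "[]"] exI[of _ 1]) simp
    ultimately show "f \<in> topspace (smooth_topology k)"
      unfolding smooth_topology_def topology_generated_by_topspace by blast
  qed
qed

definition r_immersions ::
    "nat \<Rightarrow> nat \<Rightarrow> (nat \<times> 'a::real_normed_vector \<Rightarrow> 'b::real_normed_vector) set"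
  where "r_immersions r k =
    {f \<in> smooth_maps k.
      (\<forall>(i, x)\<in>discs k. inj (frechet_derivative (\<lambda>y. f (i, y)) (at x))) \<and>
      (\<forall>z. finite {p \<in> discs k. f p = z} \<and> card {p \<in> discs k. f p = z} < r)}"

definition rImm ::
    "nat \<Rightarrow> nat \<Rightarrow> (nat \<times> 'a::real_normed_vector \<Rightarrow> 'b::real_normed_vector) topology"
  where "rImm r k = subtopology (smooth_topology k) (r_immersions r k)"


section \<open>Configurations, injective linear maps and the evaluation map\<close>

definition rConf :: "nat \<Rightarrow> nat \<Rightarrow> (nat \<Rightarrow> 'b::topological_space) topology"
  where "rConf r k = subtopology (product_topology (\<lambda>_. euclidean) {1..k})
    {x. \<not> (\<exists>I\<subseteq>{1..k}. card I = r \<and> (\<forall>i\<in>I. \<forall>j\<in>I. x i = x j))}"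

text \<open>On finite-dimensional spaces all linear maps are bounded.\<close>

definition Linj :: "('a::real_normed_vector \<Rightarrow>\<^sub>L 'b::real_normed_vector) topology"
  where "Linj = top_of_set {A. inj (blinfun_apply A)}"

definition ev ::
    "nat \<Rightarrow> (nat \<times> 'a::real_normed_vector \<Rightarrow> 'b::real_normed_vector) \<Rightarrow>
      (nat \<Rightarrow> 'b) \<times> (nat \<Rightarrow> 'a \<Rightarrow>\<^sub>L 'b)"
  where "ev k f =
    ((\<lambda>i\<in>{1..k}. f (i, 0)),
     (\<lambda>i\<in>{1..k}. Blinfun (frechet_derivative (\<lambda>x. f (i, x)) (at 0))))"

end

theory Submission
  imports Defs
begin

text \<open>
  For one disc, an immersion magnified about the centre, in source and target by the same factor,
  converges in the $C^\infty$-topology to its affine approximation, so up to homotopy an immersion is its value and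
  derivative at the centre. With several discs the magnified images could collide. This is avoided
  by first shrinking the discs, \<open>f (i, \<sigma> x)\<close>, which preserves r-immersions: if the discs are small
  compared with the distances in the r-configuration of centres, and so small that each of them is
  embedded, then all magnifications, including the affine limit, remain r-immersions
  (\<open>zoom_r_immersion\<close>). The bound on the size is locally uniform in the map
  (\<open>zoom_r_immersion_locally\<close>), hence uniform on compact families.

  The deformation \<open>zoom\<close> combines shrinking and magnifying. It fixes the values at the centres and
  multiplies the derivatives there by a positive factor, and its end, the affine map, depends only on
  the image under evaluation. Conversely every compact family in the target is lifted, up to such a
  factor, by small affine maps. Gluing these two facts along a collar shows that a family in the
  target over a cube, with a lift given over the boundary, becomes liftable over the whole cube after
  a reparametrisation and a positive rescaling of the derivatives, by a lift that on the boundary is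
  the given one reparametrised (\<open>lift_along_collar\<close>). Applied to cubes and to
  cubes times an interval this yields surjectivity and injectivity on all homotopy groups; applied
  to a point and to an interval it yields the statement on path components.

  Continuity of all these families rests on \<open>jointly_smooth_iff_continuous\<close>: a map into the space of
  smooth maps is continuous iff all iterated derivatives are jointly continuous in parameter and
  point.
\<close>

section \<open>Finite-dimensional inner product spaces\<close>

text \<open>
  An orthonormal basis. The class \<^class>\<open>fin_dim_inner\<close> has no \<^const>\<open>Basis\<close>, since it
  also contains the zero space, where this set is empty.
\<close>

definition onb :: "'a::fin_dim_inner set"
  where "onb = (SOME B. finite B \<and> (\<forall>b\<in>B. norm b = 1) \<and> (\<forall>x. x = (\<Sum>b\<in>B. (x \<bullet> b) *\<^sub>R b)))"

lemma onb_exists: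
  "\<exists>B::'a::fin_dim_inner set. finite B \<and> (\<forall>b\<in>B. norm b = 1) \<and> (\<forall>x. x = (\<Sum>b\<in>B. (x \<bullet> b) *\<^sub>R b))"
proof -
  obtain S :: "'a set" where S: "finite S" "\<And>x. \<exists>c. x = (\<Sum>b\<in>S. c b *\<^sub>R b)"
    using finite_spanning by blast
  obtain C where C: "finite C" "span C = span S" "pairwise orthogonal C"
    using basis_orthogonal[OF S(1)] by blast
  have spanS: "span S = UNIV"
  proof -
    have "x \<in> span S" for x
    proof -
      obtain c where "x = (\<Sum>b\<in>S. c b *\<^sub>R b)" using S(2) by blast
      then show ?thesis by (simp add: span_base span_scale span_sum)
    qed
    then show ?thesis by blast
  qed
  define D where "D = C - {0}"
  have D: "finite D" "span D = UNIV" "pairwise orthogonal D"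
    using C spanS by (auto simp: D_def pairwise_def span_delete_0)
  define B where "B = (\<lambda>d. d /\<^sub>R norm d) ` D"
  have finB: "finite B" and normB: "\<forall>b\<in>B. norm b = 1"
    using D(1) by (auto simp: B_def D_def)
  have orth: "b \<bullet> b' = 0" if "b \<in> B" "b' \<in> B" "b \<noteq> b'" for b b'
  proof -
    obtain d d' where d: "d \<in> D" "b = d /\<^sub>R norm d" "d' \<in> D" "b' = d' /\<^sub>R norm d'"
      using \<open>b \<in> B\<close> \<open>b' \<in> B\<close> unfolding B_def by blast
    then have "d \<bullet> d' = 0"
      using D(3) \<open>b \<noteq> b'\<close> unfolding pairwise_def orthogonal_def by metis
    then show ?thesis using d by simp
  qed
  have unit: "b \<bullet> b = 1" if "b \<in> B" for b
    using normB that by (simp add: norm_eq_1)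
  have "x = (\<Sum>b\<in>B. (x \<bullet> b) *\<^sub>R b)" for x
  proof -
    have "D \<subseteq> span B"
    proof
      fix d assume d: "d \<in> D"
      then have "d = norm d *\<^sub>R (d /\<^sub>R norm d)" by (simp add: D_def)
      moreover have "d /\<^sub>R norm d \<in> B" using d by (simp add: B_def)
      ultimately show "d \<in> span B" by (metis span_base span_scale)
    qed
    then have "span B = UNIV"
      using D(2) by (metis span_mono span_span top.extremum_unique)
    then obtain c where c: "x = (\<Sum>b\<in>B. c b *\<^sub>R b)"
      using span_finite[OF finB] by auto
    have "x \<bullet> b = c b" if "b \<in> B" for b
    proof -
      have "x \<bullet> b = (\<Sum>b'\<in>B. c b' * (b' \<bullet> b))"
        by (simp add: c inner_sum_left)
      also have "\<dots> = (\<Sum>b'\<in>B. if b' = b then c b else 0)"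
        by (intro sum.cong) (auto simp: orth[OF _ that] unit[OF that])
      finally show ?thesis using finB that by simp
    qed
    then show ?thesis by (subst (1) c) (simp cong: sum.cong)
  qed
  then show ?thesis using finB normB by blast
qed

lemma finite_onb: "finite (onb :: 'a::fin_dim_inner set)"
  and norm_onb: "b \<in> onb \<Longrightarrow> norm (b::'a) = 1"
  and onb_expansion: "(\<Sum>b\<in>onb. (x \<bullet> b) *\<^sub>R b) = (x::'a)"
  using someI_ex[OF onb_exists] unfolding onb_def[symmetric] by (blast, blast, metis)

text \<open>
  This replaces the operator norm: a linear map is controlled by its values on finitely many
  vectors, so continuity statements about derivatives only have to be made direction by direction.
\<close>

lemma norm_linear_le_onb:
  fixes L :: "'a::fin_dim_inner \<Rightarrow> 'b::real_normed_vector"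
  assumes "linear L"
  shows "norm (L x) \<le> norm x * (\<Sum>b\<in>onb. norm (L b))"
proof -
  have "L x = (\<Sum>b\<in>onb. (x \<bullet> b) *\<^sub>R L b)"
    using assms by (subst onb_expansion[symmetric, of x]) (simp add: linear_sum linear_cmul)
  also have "norm \<dots> \<le> (\<Sum>b\<in>onb. norm x * norm (L b))"
  proof (rule sum_norm_le)
    fix b :: 'a assume "b \<in> onb"
    then have "\<bar>x \<bullet> b\<bar> \<le> norm x"
      using Cauchy_Schwarz_ineq2[of x b] by (simp add: norm_onb)
    then show "norm ((x \<bullet> b) *\<^sub>R L b) \<le> norm x * norm (L b)"
      by (simp add: mult_right_mono)
  qed
  finally show ?thesis by (simp add: sum_distrib_left)
qed

lemma bounded_linear_fin_dim:
  fixes L :: "'a::fin_dim_inner \<Rightarrow> 'b::real_normed_vector"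
  shows "linear L \<Longrightarrow> bounded_linear L"
  by (rule bounded_linear_intro[OF linear_add linear_cmul norm_linear_le_onb])

text \<open>
  The ball is closed in a box of coordinates, and the box is a finite sum of compact segments.
\<close>

lemma compact_cball_fin_dim: "compact (cball (x::'a::fin_dim_inner) R)"
proof -
  have box: "compact {\<Sum>b\<in>B. c b *\<^sub>R b | c. \<forall>b\<in>B. c b \<in> {-R..R}}" if "finite B" for B :: "'a set"
    using that
  proof (induction B rule: finite_induct)
    case empty
    have "{\<Sum>b\<in>{}. c b *\<^sub>R b | c. \<forall>b\<in>{}. c b \<in> {-R..R}} = {0::'a}" by auto
    then show ?case by (metis compact_sing)
  next
    case (insert a B)
    let ?K = "\<lambda>B::'a set. {\<Sum>b\<in>B. c b *\<^sub>R b | c. \<forall>b\<in>B. c b \<in> {-R..R}}"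
    have "compact ((\<lambda>t. t *\<^sub>R a) ` {-R..R})"
      by (intro compact_continuous_image continuous_intros) simp
    from compact_sums[OF this insert.IH]
    have "compact {x + y | x y. x \<in> (\<lambda>t. t *\<^sub>R a) ` {-R..R} \<and> y \<in> ?K B}" .
    moreover have "{x + y | x y. x \<in> (\<lambda>t. t *\<^sub>R a) ` {-R..R} \<and> y \<in> ?K B} = ?K (insert a B)"
    proof (intro equalityI subsetI)
      fix z assume "z \<in> {x + y | x y. x \<in> (\<lambda>t. t *\<^sub>R a) ` {-R..R} \<and> y \<in> ?K B}"
      then obtain t c where t: "t \<in> {-R..R}" "\<forall>b\<in>B. c b \<in> {-R..R}"
        and z: "z = t *\<^sub>R a + (\<Sum>b\<in>B. c b *\<^sub>R b)" by auto
      have "(\<Sum>b\<in>B. c b *\<^sub>R b) = (\<Sum>b\<in>B. (c(a := t)) b *\<^sub>R b)"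
        using insert.hyps(2) by (intro sum.cong) auto
      then have "z = (\<Sum>b\<in>insert a B. (c(a := t)) b *\<^sub>R b)"
        using insert.hyps z by simp
      then show "z \<in> ?K (insert a B)"
        using t by (intro CollectI exI[of _ "c(a := t)"]) auto
    next
      fix z assume "z \<in> ?K (insert a B)"
      then obtain c where "\<forall>b\<in>insert a B. c b \<in> {-R..R}" "z = (\<Sum>b\<in>insert a B. c b *\<^sub>R b)"
        by auto
      then show "z \<in> {x + y | x y. x \<in> (\<lambda>t. t *\<^sub>R a) ` {-R..R} \<and> y \<in> ?K B}"
        using insert.hyps
        by (intro CollectI exI[of _ "c a *\<^sub>R a"] exI[of _ "\<Sum>b\<in>B. c b *\<^sub>R b"]) auto
    qed
    ultimately show ?case by simp
  qed
  have "cball (0::'a) R \<subseteq> {\<Sum>b\<in>onb. c b *\<^sub>R b | c. \<forall>b\<in>onb. c b \<in> {-R..R}}"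
  proof
    fix y :: 'a assume y: "y \<in> cball 0 R"
    have "\<forall>b\<in>onb. y \<bullet> b \<in> {-R..R}"
    proof
      fix b :: 'a assume "b \<in> onb"
      then have "\<bar>y \<bullet> b\<bar> \<le> norm y"
        using Cauchy_Schwarz_ineq2[of y b] by (simp add: norm_onb)
      then show "y \<bullet> b \<in> {-R..R}" using y by auto
    qed
    moreover have "y = (\<Sum>b\<in>onb. (y \<bullet> b) *\<^sub>R b)" by (simp add: onb_expansion)
    ultimately show "y \<in> {\<Sum>b\<in>onb. c b *\<^sub>R b | c. \<forall>b\<in>onb. c b \<in> {-R..R}}"
      by (intro CollectI exI[of _ "\<lambda>b. y \<bullet> b"]) simp
  qed
  then have "compact (cball (0::'a) R)"
    by (metis (no_types, lifting) compact_Int_closed[OF box[OF finite_onb] closed_cball] Int_absorb1 inf.commute)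
  then have "compact ((+) x ` cball 0 R)"
    by (rule compact_translation)
  then show ?thesis by simp
qed

text \<open>
  The norm of the image attains a positive minimum on the unit sphere; in the zero space the
  sphere is empty and every constant works.
\<close>

lemma inj_linear_bounded_below:
  fixes L :: "'a::fin_dim_inner \<Rightarrow> 'b::real_normed_vector"
  assumes "linear L" "inj L"
  obtains \<mu> where "\<mu> > 0" "\<And>v. \<mu> * norm v \<le> norm (L v)"
proof (cases "sphere (0::'a) 1 = {}")
  case True
  have "norm v = 0" for v :: 'a
  proof (rule ccontr)
    assume "norm v \<noteq> 0"
    then have "v /\<^sub>R norm v \<in> sphere 0 1" by simp
    then show False using True by simp
  qed
  then show ?thesis by (intro that[of 1]) (metis mult_1 norm_ge_zero zero_less_one)+
next
  case False
  have "closed ({v. norm (v::'a) = 1})"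
    by (intro closed_Collect_eq continuous_intros)
  then have "closed (sphere (0::'a) 1)" by (simp add: sphere_def)
  then have "compact (cball (0::'a) 1 \<inter> sphere 0 1)"
    by (intro compact_Int_closed compact_cball_fin_dim)
  moreover have "cball (0::'a) 1 \<inter> sphere 0 1 = sphere 0 1" by auto
  ultimately have "compact (sphere (0::'a) 1)" by simp
  moreover have "continuous_on (sphere 0 1) (\<lambda>v. norm (L v))"
    by (intro continuous_on_norm linear_continuous_on bounded_linear_fin_dim assms)
  ultimately obtain u where u: "u \<in> sphere 0 1" "\<And>v. v \<in> sphere 0 1 \<Longrightarrow> norm (L u) \<le> norm (L v)"
    using False continuous_attains_inf by metis
  have "u \<noteq> 0" using u(1) by auto
  then have pos: "norm (L u) > 0"
    using assms linear_injective_0 by auto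
  have "norm (L u) * norm v \<le> norm (L v)" for v
  proof (cases "v = 0")
    case False
    then have "norm (L u) \<le> norm (L (v /\<^sub>R norm v))" by (intro u(2)) simp
    also have "\<dots> = norm (L v) / norm v"
      using assms(1) by (simp add: linear_cmul divide_inverse mult.commute)
    finally show ?thesis using False by (simp add: field_simps)
  qed simp
  with pos show ?thesis by (rule that)
qed

section \<open>Continuous families of smooth maps\<close>

lemma continuous_map_euclideanI:
  fixes f :: "'z \<Rightarrow> 'b::real_normed_vector"
  assumes "\<And>z e. z \<in> topspace Z \<Longrightarrow> e > 0 \<Longrightarrow>
    \<exists>U. openin Z U \<and> z \<in> U \<and> (\<forall>y\<in>U. norm (f y - f z) < e)"
  shows "continuous_map Z euclidean f"
proof -
  have "continuous_map Z Met_TC.mtopology f"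
    unfolding Met_TC.continuous_map_to_metric
    using assms by (simp add: Met_TC.in_mball dist_norm norm_minus_commute)
  then show ?thesis by simp
qed

text \<open>
  The tube lemma: projecting along a compact factor is a closed map.
\<close>

lemma openin_tube_less:
  fixes g :: "'z \<times> 'a::real_normed_vector \<Rightarrow> real"
  assumes g: "continuous_map (prod_topology Z (top_of_set S)) euclideanreal g"
    and K: "compact K" "K \<subseteq> S"
  shows "openin Z {z \<in> topspace Z. \<forall>x\<in>K. g (z, x) < e}"
proof -
  have "continuous_map (prod_topology Z (top_of_set K)) (top_of_set S) snd"
    using K(2) continuous_map_into_fulltopology[OF continuous_map_snd[of Z "top_of_set K"]]
    by (auto simp: continuous_map_in_subtopology)
  from continuous_map_compose[OF continuous_map_pairedI[OF continuous_map_fst this] g]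
  have "continuous_map (prod_topology Z (top_of_set K)) euclideanreal g"
    by (simp add: o_def)
  then have "closedin (prod_topology Z (top_of_set K)) {p \<in> topspace (prod_topology Z (top_of_set K)). g p \<in> {e..}}"
    by (rule closedin_continuous_map_preimage) simp
  moreover have "closed_map (prod_topology Z (top_of_set K)) Z fst"
    by (rule closed_map_fst) (use K in \<open>simp add: compact_space_subtopology\<close>)
  ultimately have "closedin Z (fst ` {p \<in> topspace (prod_topology Z (top_of_set K)). g p \<in> {e..}})"
    unfolding closed_map_def by blast
  then have "openin Z (topspace Z - fst ` {p \<in> topspace (prod_topology Z (top_of_set K)). g p \<in> {e..}})"
    by blast
  moreover have "topspace Z - fst ` {p \<in> topspace (prod_topology Z (top_of_set K)). g p \<in> {e..}}
      = {z \<in> topspace Z. \<forall>x\<in>K. g (z, x) < e}"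
    by (auto simp: image_iff not_le) blast
  ultimately show ?thesis by simp
qed

text \<open>
  The exponential law for the compact-open $C^\infty$-topology: a family of smooth maps depends
  continuously on its parameter iff all iterated derivatives are jointly continuous in parameter
  and point. The joint form is the one that survives composition with reparametrisations.
\<close>

definition jointly_smooth ::
    "'z topology \<Rightarrow> nat \<Rightarrow> ('z \<Rightarrow> nat \<times> 'a::real_normed_vector \<Rightarrow> 'b::real_normed_vector) \<Rightarrow> bool"
  where "jointly_smooth Z k F \<longleftrightarrow> (\<forall>z\<in>topspace Z. F z \<in> smooth_maps k) \<and>
    (\<forall>i\<in>{1..k}. \<forall>vs. continuous_map (prod_topology Z (top_of_set (ball 0 1))) euclidean
      (\<lambda>(z, x). iter_deriv vs (\<lambda>y. F z (i, y)) x))"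

lemma smooth_maps_smooth_on:
  "f \<in> smooth_maps k \<Longrightarrow> i \<in> {1..k} \<Longrightarrow> smooth_on (ball 0 1) (\<lambda>x. f (i, x))"
  by (simp add: smooth_maps_def)

lemma smooth_on_continuous:
  assumes "smooth_on U f"
  shows "continuous_on U (iter_deriv vs f)"
  using assms unfolding smooth_on_def
  by (meson continuous_at_imp_continuous_on differentiable_imp_continuous_within)

lemma continuous_map_second_argument:
  assumes "continuous_on S f"
  shows "continuous_map (prod_topology Z (top_of_set S)) euclidean (\<lambda>(z, x). f x)"
  using continuous_map_compose[OF continuous_map_snd, of "top_of_set S" euclidean f Z] assms
  by (simp add: o_def case_prod_unfold)

lemma jointly_smooth_imp_continuous:
  fixes F :: "'z \<Rightarrow> nat \<times> 'a::real_normed_vector \<Rightarrow> 'b::real_normed_vector"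
  assumes "jointly_smooth Z k F"
  shows "continuous_map Z (smooth_topology k) F"
  unfolding smooth_topology_def
proof (rule continuous_on_generated_topo)
  have F: "F z \<in> smooth_maps k" if "z \<in> topspace Z" for z
    using assms that by (simp add: jointly_smooth_def)
  show "F ` topspace Z \<subseteq> \<Union> {smooth_nbhd k f K vs \<epsilon> | f K vs \<epsilon>.
      f \<in> smooth_maps k \<and> compact K \<and> K \<subseteq> discs k \<and> 0 < \<epsilon>}"
    using F topspace_smooth_topology[of k]
    unfolding smooth_topology_def topology_generated_by_topspace by blast
  fix U :: "(nat \<times> 'a \<Rightarrow> 'b) set"
  assume "U \<in> {smooth_nbhd k f K vs \<epsilon> | f K vs \<epsilon>.
      f \<in> smooth_maps k \<and> compact K \<and> K \<subseteq> discs k \<and> 0 < \<epsilon>}"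
  then obtain f K vs \<epsilon> where U: "U = smooth_nbhd k f K vs \<epsilon>" and f: "f \<in> smooth_maps k"
    and K: "compact K" "K \<subseteq> discs k" by blast
  define Ki where "Ki i = Pair i -` K" for i
  have Ki: "compact (Ki i)" "Ki i \<subseteq> ball 0 1" for i
  proof -
    have "Ki i = snd ` (K \<inter> {i} \<times> UNIV)" by (force simp: Ki_def)
    moreover have "compact (K \<inter> {i} \<times> UNIV)"
      by (intro compact_Int_closed K closed_Times) auto
    ultimately show "compact (Ki i)" by (simp add: compact_continuous_image continuous_on_snd)
    show "Ki i \<subseteq> ball 0 1" using K(2) by (auto simp: Ki_def discs_def)
  qed
  define V where "V i = {z \<in> topspace Z. \<forall>x\<in>Ki i.
      norm (iter_deriv vs (\<lambda>y. F z (i, y)) x - iter_deriv vs (\<lambda>y. f (i, y)) x) < \<epsilon>}" for i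
  have V: "openin Z (V i)" if i: "i \<in> {1..k}" for i
  proof -
    have "continuous_map (prod_topology Z (top_of_set (ball 0 1))) euclideanreal
      (\<lambda>p. norm ((\<lambda>(z, x). iter_deriv vs (\<lambda>y. F z (i, y)) x) p -
          (\<lambda>(z, x). iter_deriv vs (\<lambda>y. f (i, y)) x) p))"
      using assms i smooth_maps_smooth_on[OF f i]
      by (intro continuous_intros continuous_map_second_argument smooth_on_continuous)
        (auto simp: jointly_smooth_def)
    from openin_tube_less[OF this Ki, where e = \<epsilon>] show ?thesis by (simp add: V_def)
  qed
  have "F -` U \<inter> topspace Z = topspace Z \<inter> (\<Inter>i\<in>{1..k}. V i)"
    using F K(2) by (force simp: U smooth_nbhd_def V_def Ki_def discs_def)
  moreover have "openin Z (topspace Z \<inter> (\<Inter>i\<in>{1..k}. V i))"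
  proof (cases "k = 0")
    case False
    then have "openin Z (\<Inter>i\<in>{1..k}. V i)" using V by (intro openin_INT2) auto
    then show ?thesis by blast
  qed simp
  ultimately show "openin Z (F -` U \<inter> topspace Z)" by simp
qed

lemma continuous_imp_jointly_smooth:
  fixes F :: "'z \<Rightarrow> nat \<times> 'a::fin_dim_inner \<Rightarrow> 'b::real_normed_vector"
  assumes "continuous_map Z (smooth_topology k) F"
  shows "jointly_smooth Z k F"
  unfolding jointly_smooth_def
proof (intro conjI ballI allI)
  show F: "F z \<in> smooth_maps k" if "z \<in> topspace Z" for z
    using assms that continuous_map_image_subset_topspace topspace_smooth_topology by blast
  fix i vs assume i: "i \<in> {1..k}"
  let ?D = "\<lambda>z. iter_deriv vs (\<lambda>y. F z (i, y))"
  show "continuous_map (prod_topology Z (top_of_set (ball 0 1))) euclidean (\<lambda>(z, x). ?D z x)"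
  proof (rule continuous_map_euclideanI)
    fix p and e :: real
    assume "p \<in> topspace (prod_topology Z (top_of_set (ball (0::'a) 1)))" and e: "e > 0"
    then obtain z0 x0 where p: "p = (z0, x0)" "z0 \<in> topspace Z" "x0 \<in> ball 0 1"
      by auto
    obtain \<delta> where \<delta>: "\<delta> > 0" "cball x0 \<delta> \<subseteq> ball 0 1"
      using p(3) open_contains_cball open_ball by blast
    let ?K = "{i} \<times> cball x0 \<delta>"
    have "openin (smooth_topology k) (smooth_nbhd k (F z0) ?K vs (e/2))"
      unfolding smooth_topology_def
    proof (rule topology_generated_by_Basis,
        intro CollectI exI[of _ "F z0"] exI[of _ ?K] exI[of _ vs] exI[of _ "e/2"] conjI)
      show "compact ?K" by (intro compact_Times compact_cball_fin_dim) simp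
      show "?K \<subseteq> discs k" using \<delta> i by (auto simp: discs_def)
    qed (use F p e in auto)
    then have N: "openin Z {z \<in> topspace Z. F z \<in> smooth_nbhd k (F z0) ?K vs (e/2)}"
      by (rule openin_continuous_map_preimage[OF assms])
    have "continuous_on (ball 0 1) (?D z0)"
      by (rule smooth_on_continuous[OF smooth_maps_smooth_on[OF F[OF p(2)] i]])
    then have "openin (top_of_set (ball 0 1)) {x \<in> ball 0 1. ?D z0 x \<in> ball (?D z0 x0) (e/2)}"
      using openin_continuous_map_preimage[of "top_of_set (ball 0 1)" euclidean "?D z0" "ball (?D z0 x0) (e/2)"]
      by (simp del: mem_ball)
    moreover have "openin (top_of_set (ball 0 1)) (ball 0 1 \<inter> ball x0 \<delta>)"
      by (simp add: openin_open_Int)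
    ultimately have M: "openin (top_of_set (ball 0 1))
        ({x \<in> ball 0 1. ?D z0 x \<in> ball (?D z0 x0) (e/2)} \<inter> (ball 0 1 \<inter> ball x0 \<delta>))"
      by (rule openin_Int)
    let ?N = "{z \<in> topspace Z. F z \<in> smooth_nbhd k (F z0) ?K vs (e/2)}"
    let ?M = "{x \<in> ball 0 1. ?D z0 x \<in> ball (?D z0 x0) (e/2)} \<inter> (ball 0 1 \<inter> ball x0 \<delta>)"
    show "\<exists>U. openin (prod_topology Z (top_of_set (ball 0 1))) U \<and> p \<in> U \<and>
        (\<forall>y\<in>U. norm ((\<lambda>(z, x). ?D z x) y - (\<lambda>(z, x). ?D z x) p) < e)"
    proof (intro exI[of _ "?N \<times> ?M"] conjI ballI)
      show "openin (prod_topology Z (top_of_set (ball 0 1))) (?N \<times> ?M)"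
        using N M by (simp add: openin_prod_Times_iff)
      show "p \<in> ?N \<times> ?M"
        using p \<delta> e F by (auto simp: smooth_nbhd_def)
      fix y assume "y \<in> ?N \<times> ?M"
      then obtain z x where y: "y = (z, x)" "z \<in> ?N" "x \<in> ?M" by auto
      have "norm (?D z x - ?D z0 x) < e/2"
        using y by (auto simp: smooth_nbhd_def)
      moreover have "norm (?D z0 x - ?D z0 x0) < e/2"
        using y by (simp add: dist_norm norm_minus_commute)
      ultimately have "norm ((?D z x - ?D z0 x) + (?D z0 x - ?D z0 x0)) < e"
        using norm_triangle_ineq[of "?D z x - ?D z0 x" "?D z0 x - ?D z0 x0"] by linarith
      then show "norm ((\<lambda>(z, x). ?D z x) y - (\<lambda>(z, x). ?D z x) p) < e"
        by (simp add: y p)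
    qed
  qed
qed

lemma jointly_smooth_iff_continuous:
  fixes F :: "'z \<Rightarrow> nat \<times> 'a::fin_dim_inner \<Rightarrow> 'b::real_normed_vector"
  shows "continuous_map Z (smooth_topology k) F \<longleftrightarrow> jointly_smooth Z k F"
  using jointly_smooth_imp_continuous continuous_imp_jointly_smooth by blast

text \<open>
  By the mean value inequality on a compact ball, a family of functions that agree up to a small
  error at the origin, and whose derivatives agree up to a small error on that ball, is uniformly
  close. This is how the values of a rescaled map are controlled where a difference quotient
  degenerates.
\<close>

lemma joint_continuity_from_derivative:
  fixes \<Phi> :: "'z \<Rightarrow> 'a::fin_dim_inner \<Rightarrow> 'b::real_normed_vector"
  assumes der: "\<And>z x. z \<in> topspace Z \<Longrightarrow> x \<in> ball 0 1 \<Longrightarrow> (\<Phi> z has_derivative \<Phi>' z x) (at x)"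
    and cont: "\<And>v. continuous_map (prod_topology Z (top_of_set (ball 0 1))) euclidean
      (\<lambda>(z, x). \<Phi>' z x v)"
    and c0: "continuous_map Z euclidean (\<lambda>z. \<Phi> z 0)"
  shows "continuous_map (prod_topology Z (top_of_set (ball 0 1))) euclidean (\<lambda>(z, x). \<Phi> z x)"
proof (rule continuous_map_euclideanI)
  fix p and e :: real
  assume "p \<in> topspace (prod_topology Z (top_of_set (ball (0::'a) 1)))" and e: "e > 0"
  then obtain z0 x0 where p: "p = (z0, x0)" "z0 \<in> topspace Z" "x0 \<in> ball 0 1"
    by auto
  define \<rho> where "\<rho> = (1 + norm x0) / 2"
  have \<rho>: "0 < \<rho>" "\<rho> < 1" "norm x0 < \<rho>"
    using p(3) norm_ge_zero[of x0] by (auto simp: \<rho>_def simp del: norm_ge_zero)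
  have K: "compact (cball (0::'a) \<rho>)" "cball (0::'a) \<rho> \<subseteq> ball 0 1"
    using \<rho> by (auto intro: compact_cball_fin_dim)
  let ?P = "prod_topology Z (top_of_set (ball (0::'a) 1))"
  have "continuous_map ?P ?P (\<lambda>p. (z0, snd p))"
    using p(2) by (intro continuous_map_pairedI continuous_map_snd) simp
  from continuous_map_compose[OF this cont]
  have cont0: "continuous_map ?P euclidean (\<lambda>p. \<Phi>' z0 (snd p) v)" for v
    by (simp add: o_def)
  have "continuous_map ?P euclideanreal
      (\<lambda>p. \<Sum>b\<in>onb. norm ((\<lambda>(z, x). \<Phi>' z x b) p - \<Phi>' z0 (snd p) b))"
    by (intro continuous_intros finite_onb cont cont0)
  from openin_tube_less[OF this K, where e = "e/3"]
  have N1: "openin Z {z \<in> topspace Z. \<forall>x\<in>cball 0 \<rho>. (\<Sum>b\<in>onb. norm (\<Phi>' z x b - \<Phi>' z0 x b)) < e/3}"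
    (is "openin Z ?N1") by simp
  have "openin Z {z \<in> topspace Z. \<Phi> z 0 \<in> ball (\<Phi> z0 0) (e/3)}" (is "openin Z ?N2")
    by (rule openin_continuous_map_preimage[OF c0]) simp
  with N1 have N: "openin Z (?N1 \<inter> ?N2)" by (rule openin_Int)
  have "continuous_on (ball 0 1) (\<Phi> z0)"
    using der[OF p(2)] by (meson continuous_at_imp_continuous_on has_derivative_continuous)
  then have "openin (top_of_set (ball 0 1)) {x \<in> ball 0 1. \<Phi> z0 x \<in> ball (\<Phi> z0 x0) (e/3)}"
    using openin_continuous_map_preimage[of "top_of_set (ball 0 1)" euclidean "\<Phi> z0" "ball (\<Phi> z0 x0) (e/3)"]
    by (simp del: mem_ball)
  moreover have "openin (top_of_set (ball 0 1)) (ball 0 1 \<inter> ball (0::'a) \<rho>)"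
    by (simp add: openin_open_Int)
  ultimately have M: "openin (top_of_set (ball 0 1))
     ({x \<in> ball 0 1. \<Phi> z0 x \<in> ball (\<Phi> z0 x0) (e/3)} \<inter> (ball 0 1 \<inter> ball 0 \<rho>))" (is "openin _ ?M")
    by (rule openin_Int)
  show "\<exists>U. openin ?P U \<and> p \<in> U \<and> (\<forall>y\<in>U. norm ((\<lambda>(z, x). \<Phi> z x) y - (\<lambda>(z, x). \<Phi> z x) p) < e)"
  proof (intro exI[of _ "(?N1 \<inter> ?N2) \<times> ?M"] conjI ballI)
    show "openin ?P ((?N1 \<inter> ?N2) \<times> ?M)"
      using N M by (simp add: openin_prod_Times_iff)
    show "p \<in> (?N1 \<inter> ?N2) \<times> ?M"
      using p \<rho> e by auto
    fix y assume "y \<in> (?N1 \<inter> ?N2) \<times> ?M"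
    then obtain z x where y: "y = (z, x)" "z \<in> ?N1" "z \<in> ?N2" "x \<in> ?M" by auto
    let ?\<Delta> = "\<lambda>x. \<Phi> z x - \<Phi> z0 x"
    have "norm (?\<Delta> x - ?\<Delta> 0) \<le> e/3 * norm (x - 0)"
    proof (rule differentiable_bound)
      show "convex (cball (0::'a) \<rho>)" by simp
      fix w :: 'a assume w: "w \<in> cball 0 \<rho>"
      then have w1: "w \<in> ball 0 1" using K by blast
      have d: "(?\<Delta> has_derivative (\<lambda>v. \<Phi>' z w v - \<Phi>' z0 w v)) (at w)"
        using y p w1 by (intro derivative_intros der) auto
      then show "(?\<Delta> has_derivative (\<lambda>v. \<Phi>' z w v - \<Phi>' z0 w v)) (at w within cball 0 \<rho>)"
        by (rule has_derivative_at_withinI)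
      show "onorm (\<lambda>v. \<Phi>' z w v - \<Phi>' z0 w v) \<le> e/3"
      proof (rule onorm_bound)
        fix v
        have "norm (\<Phi>' z w v - \<Phi>' z0 w v) \<le> norm v * (\<Sum>b\<in>onb. norm (\<Phi>' z w b - \<Phi>' z0 w b))"
          by (rule norm_linear_le_onb) (rule has_derivative_linear[OF d])
        also have "\<dots> \<le> norm v * (e/3)"
          using y(2) w by (intro mult_left_mono) (auto intro: less_imp_le)
        finally show "norm (\<Phi>' z w v - \<Phi>' z0 w v) \<le> e/3 * norm v" by (simp add: mult.commute)
      qed (use e in simp)
    qed (use y \<rho> in auto)
    also have "\<dots> \<le> e/3"
      using y(4) e by (simp add: mult_left_le less_imp_le)
    finally have 1: "norm (?\<Delta> x - ?\<Delta> 0) \<le> e/3" .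
    have 2: "norm (?\<Delta> 0) < e/3"
      using y(3) by (simp add: dist_norm norm_minus_commute)
    have 3: "norm (\<Phi> z0 x - \<Phi> z0 x0) < e/3"
      using y(4) by (simp add: dist_norm norm_minus_commute)
    have tri: "norm (a + b + c) \<le> norm a + norm b + norm c" for a b c :: 'b
      using norm_triangle_ineq[of "a + b" c] norm_triangle_ineq[of a b] by linarith
    have "\<Phi> z x - \<Phi> z0 x0 = (?\<Delta> x - ?\<Delta> 0) + ?\<Delta> 0 + (\<Phi> z0 x - \<Phi> z0 x0)" by simp
    then have "norm (\<Phi> z x - \<Phi> z0 x0) \<le>
        norm (?\<Delta> x - ?\<Delta> 0) + norm (?\<Delta> 0) + norm (\<Phi> z0 x - \<Phi> z0 x0)"
      by (simp only: tri)
    with 1 2 3 show "norm ((\<lambda>(z, x). \<Phi> z x) y - (\<lambda>(z, x). \<Phi> z x) p) < e"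
      by (simp add: y p)
  qed
qed

section \<open>Rescaling a map near the origin\<close>

lemma smooth_on_has_derivative:
  assumes "smooth_on U f" "x \<in> U"
  shows "(iter_deriv vs f has_derivative (\<lambda>v. iter_deriv (v # vs) f x)) (at x)"
  using assms by (simp add: smooth_on_def frechet_derivative_works)

text \<open>
  A list-indexed family in which each member differentiates to the next one has to consist of the
  iterated derivatives. This reduces every computation of \<^const>\<open>iter_deriv\<close> to guessing the
  closed form.
\<close>

lemma iter_deriv_unique:
  fixes g :: "'a::real_normed_vector \<Rightarrow> 'b::real_normed_vector"
  assumes U: "open U"
    and base: "\<And>x. x \<in> U \<Longrightarrow> g x = D [] x"
    and step: "\<And>vs x. x \<in> U \<Longrightarrow> (D vs has_derivative (\<lambda>v. D (v # vs) x)) (at x)"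
  shows "smooth_on U g" and "x \<in> U \<Longrightarrow> iter_deriv vs g x = D vs x"
proof -
  have eq: "\<forall>x\<in>U. iter_deriv vs g x = D vs x" for vs
  proof (induction vs)
    case Nil
    show ?case using base by simp
  next
    case (Cons v vs)
    show ?case
    proof
      fix x assume x: "x \<in> U"
      have "(iter_deriv vs g has_derivative (\<lambda>v. D (v # vs) x)) (at x)"
        using has_derivative_transform_within_open[OF step[OF x] U x] Cons.IH by metis
      from frechet_derivative_at[OF this] show "iter_deriv (v # vs) g x = D (v # vs) x"
        by (simp add: fun_eq_iff)
    qed
  qed
  then show "x \<in> U \<Longrightarrow> iter_deriv vs g x = D vs x" by blast
  have "(iter_deriv vs g has_derivative (\<lambda>v. D (v # vs) x)) (at x)" if "x \<in> U" for vs x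
    using has_derivative_transform_within_open[OF step[OF that] U that] eq by metis
  then show "smooth_on U g"
    unfolding smooth_on_def differentiable_def by blast
qed

text \<open>
  The two-parameter deformation behind the whole proof. For \<open>s = 1\<close> it is the restriction
  $f(\sigma x)$ of \<open>f\<close> to a smaller disc; for $0 < s \le 1$ it magnifies the picture by $1/s$ about
  the centre; at \<open>s = 0\<close> it becomes the affine map $f(0) + \sigma f'(0)x$. Throughout, the value at
  the centre is unchanged and the derivative there is $\sigma f'(0)$.
\<close>

definition zoom ::
    "nat \<Rightarrow> real \<Rightarrow> real \<Rightarrow> (nat \<times> 'a::real_normed_vector \<Rightarrow> 'b::real_normed_vector) \<Rightarrow> nat \<times> 'a \<Rightarrow> 'b"
  where "zoom k \<sigma> s f = restrict (\<lambda>(i, x). f (i, 0) +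
    (if s = 0 then \<sigma> *\<^sub>R frechet_derivative (\<lambda>y. f (i, y)) (at 0) x
     else (f (i, (s * \<sigma>) *\<^sub>R x) - f (i, 0)) /\<^sub>R s)) (discs k)"

text \<open>
  The derivatives of positive order of the deformed map. The truncated subtraction and
  $0^0 = 1$ make the formula correct at \<open>s = 0\<close>, where only the first derivative survives, so
  positive order needs no case distinction.
\<close>

definition zoom_deriv ::
    "real \<Rightarrow> real \<Rightarrow> ('a::real_normed_vector \<Rightarrow> 'b::real_normed_vector) \<Rightarrow> 'a list \<Rightarrow> 'a \<Rightarrow> 'b"
  where "zoom_deriv \<sigma> s g vs x = (s ^ (length vs - 1) * \<sigma> ^ length vs) *\<^sub>R iter_deriv vs g ((s * \<sigma>) *\<^sub>R x)"

lemma scale_in_ball: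
  assumes "0 \<le> s" "s \<le> (1::real)" "x \<in> ball 0 R"
  shows "s *\<^sub>R x \<in> ball (0::'a::real_normed_vector) R"
proof -
  have "norm (s *\<^sub>R x) \<le> norm x"
    using assms by (simp add: mult_left_le_one_le)
  then show ?thesis using assms(3) by simp
qed

context
  fixes f :: "nat \<times> 'a::real_normed_vector \<Rightarrow> 'b::real_normed_vector"
    and k i :: nat and \<sigma> s :: real
  assumes f: "f \<in> smooth_maps k" and i: "i \<in> {1..k}"
    and \<sigma>: "0 < \<sigma>" "\<sigma> \<le> 1" and s: "0 \<le> s" "s \<le> 1"
begin

lemma zoom_derivatives:
  shows "smooth_on (ball 0 1) (\<lambda>y. zoom k \<sigma> s f (i, y))"
    and "vs \<noteq> [] \<Longrightarrow> x \<in> ball 0 1 \<Longrightarrow>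
      iter_deriv vs (\<lambda>y. zoom k \<sigma> s f (i, y)) x = zoom_deriv \<sigma> s (\<lambda>y. f (i, y)) vs x"
proof -
  let ?f = "\<lambda>y. f (i, y)"
  define Z0 where "Z0 x = f (i, 0) + (if s = 0 then \<sigma> *\<^sub>R frechet_derivative ?f (at 0) x
     else (f (i, (s * \<sigma>) *\<^sub>R x) - f (i, 0)) /\<^sub>R s)" for x
  define D where "D vs = (if vs = [] then Z0 else zoom_deriv \<sigma> s ?f vs)" for vs
  have smooth: "smooth_on (ball 0 1) ?f" using f i by (rule smooth_maps_smooth_on)
  have s\<sigma>: "0 \<le> s * \<sigma>" "s * \<sigma> \<le> 1" using \<sigma> s by (simp_all add: mult_le_one)
  have chain: "((\<lambda>x. iter_deriv vs ?f ((s * \<sigma>) *\<^sub>R x)) has_derivative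
      (\<lambda>v. (s * \<sigma>) *\<^sub>R iter_deriv (v # vs) ?f ((s * \<sigma>) *\<^sub>R x))) (at x)" if "x \<in> ball 0 1" for vs x
  proof -
    have h: "(iter_deriv vs ?f has_derivative (\<lambda>v. iter_deriv (v # vs) ?f ((s * \<sigma>) *\<^sub>R x)))
        (at ((s * \<sigma>) *\<^sub>R x))"
      by (rule smooth_on_has_derivative[OF smooth scale_in_ball[OF s\<sigma> that]])
    have "((\<lambda>x. (s * \<sigma>) *\<^sub>R x) has_derivative (\<lambda>v. (s * \<sigma>) *\<^sub>R v)) (at x)"
      by (intro derivative_intros)
    from diff_chain_at[OF this h] show ?thesis
      using linear_cmul[OF has_derivative_linear[OF h]] by (simp add: o_def)
  qed
  have step: "(D vs has_derivative (\<lambda>v. D (v # vs) x)) (at x)" if x: "x \<in> ball 0 1" for vs x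
  proof (cases vs)
    case Nil
    show ?thesis
    proof (cases "s = 0")
      case True
      have "bounded_linear (frechet_derivative ?f (at 0))"
        using has_derivative_bounded_linear[OF smooth_on_has_derivative[OF smooth, of 0 "[]"]] by simp
      then show ?thesis
        by (auto simp: D_def Nil True Z0_def[abs_def] zoom_deriv_def
            intro!: derivative_eq_intros bounded_linear_imp_has_derivative)
    next
      case False
      have "(Z0 has_derivative (\<lambda>v. 0 + ((s * \<sigma>) *\<^sub>R iter_deriv [v] ?f ((s * \<sigma>) *\<^sub>R x) - 0) /\<^sub>R s)) (at x)"
        using has_derivative_add[OF has_derivative_const has_derivative_scaleR_right[OF
              has_derivative_diff[OF chain[OF x, of "[]"] has_derivative_const]]]
        by (simp add: Z0_def[abs_def] False)
      then show ?thesis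
        using False by (simp add: D_def Nil zoom_deriv_def mult.assoc[symmetric])
    qed
  next
    case (Cons w ws)
    have "((\<lambda>x. (s ^ length ws * \<sigma> ^ length vs) *\<^sub>R iter_deriv vs ?f ((s * \<sigma>) *\<^sub>R x)) has_derivative
       (\<lambda>v. (s ^ length ws * \<sigma> ^ length vs) *\<^sub>R (s * \<sigma>) *\<^sub>R iter_deriv (v # vs) ?f ((s * \<sigma>) *\<^sub>R x))) (at x)"
      by (rule has_derivative_scaleR_right[OF chain[OF x]])
    then show ?thesis
      by (simp add: D_def zoom_deriv_def[abs_def] Cons mult_ac)
  qed
  have base: "zoom k \<sigma> s f (i, x) = D [] x" if "x \<in> ball 0 1" for x
    using that i by (simp add: zoom_def discs_def D_def Z0_def)
  show "smooth_on (ball 0 1) (\<lambda>y. zoom k \<sigma> s f (i, y))"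
    by (rule iter_deriv_unique(1)[OF open_ball base step])
  show "iter_deriv vs (\<lambda>y. zoom k \<sigma> s f (i, y)) x = zoom_deriv \<sigma> s ?f vs x"
    if "vs \<noteq> []" "x \<in> ball 0 1"
    using iter_deriv_unique(2)[of "ball 0 1" "\<lambda>y. zoom k \<sigma> s f (i, y)" D, OF open_ball base step that(2)] that(1)
    by (simp add: D_def)
qed

lemma zoom_frechet_derivative:
  assumes x: "x \<in> ball 0 1"
  shows "frechet_derivative (\<lambda>y. zoom k \<sigma> s f (i, y)) (at x) v =
    \<sigma> *\<^sub>R frechet_derivative (\<lambda>y. f (i, y)) (at ((s * \<sigma>) *\<^sub>R x)) v"
  using zoom_derivatives(2)[of "[v]", OF _ x] by (simp add: zoom_deriv_def)

lemma zoom_at_0: "zoom k \<sigma> s f (i, 0) = f (i, 0)"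
proof -
  have "linear (frechet_derivative (\<lambda>y. f (i, y)) (at 0))"
    using smooth_on_has_derivative[OF smooth_maps_smooth_on[OF f i], of 0 "[]"]
    by (simp add: has_derivative_linear)
  then show ?thesis
    using i by (simp add: zoom_def discs_def linear_0)
qed

end

lemma zoom_smooth_maps:
  assumes "f \<in> smooth_maps k" "0 < \<sigma>" "\<sigma> \<le> 1" "0 \<le> s" "s \<le> 1"
  shows "zoom k \<sigma> s f \<in> smooth_maps k"
  using zoom_derivatives(1)[OF assms(1) _ assms(2-5)]
  by (auto simp: smooth_maps_def zoom_def)

lemma zoom_1_1:
  assumes "f \<in> smooth_maps k"
  shows "zoom k 1 1 f = f"
proof
  fix p
  show "zoom k 1 1 f p = f p"
    using assms by (cases p; cases "p \<in> discs k") (auto simp: zoom_def smooth_maps_def extensional_def)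
qed

lemma continuous_map_scaleR:
  fixes g :: "'z \<Rightarrow> 'b::real_normed_vector"
  shows "continuous_map Z euclideanreal c \<Longrightarrow> continuous_map Z euclidean g \<Longrightarrow>
    continuous_map Z euclidean (\<lambda>z. c z *\<^sub>R g z)"
  by (simp add: continuous_map_atin tendsto_scaleR)

text \<open>
  Derivatives of positive order are polynomial in \<open>s\<close> and \<open>\<sigma>\<close>, hence continuous up to \<open>s = 0\<close>. The
  values themselves involve a division by \<open>s\<close>; they are recovered from the first derivative and
  the constant value at the centre.
\<close>

lemma jointly_smooth_zoom:
  fixes F :: "'z \<Rightarrow> nat \<times> 'a::fin_dim_inner \<Rightarrow> 'b::real_normed_vector"
  assumes F: "jointly_smooth Z k F"
    and \<sigma>: "continuous_map Z euclideanreal \<sigma>" "\<And>z. z \<in> topspace Z \<Longrightarrow> 0 < \<sigma> z \<and> \<sigma> z \<le> 1"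
    and s: "continuous_map Z euclideanreal s" "\<And>z. z \<in> topspace Z \<Longrightarrow> 0 \<le> s z \<and> s z \<le> 1"
  shows "jointly_smooth Z k (\<lambda>z. zoom k (\<sigma> z) (s z) (F z))"
  unfolding jointly_smooth_def
proof (intro conjI ballI allI)
  have Fz: "F z \<in> smooth_maps k" if "z \<in> topspace Z" for z
    using F that by (simp add: jointly_smooth_def)
  show "zoom k (\<sigma> z) (s z) (F z) \<in> smooth_maps k" if "z \<in> topspace Z" for z
    using Fz[OF that] \<sigma>(2)[OF that] s(2)[OF that] by (simp add: zoom_smooth_maps)
  fix i vs assume i: "i \<in> {1..k}"
  let ?P = "prod_topology Z (top_of_set (ball (0::'a) 1))"
  let ?zoom = "\<lambda>z y. zoom k (\<sigma> z) (s z) (F z) (i, y)"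
  let ?zd = "\<lambda>vs z. zoom_deriv (\<sigma> z) (s z) (\<lambda>y. F z (i, y)) vs"
  have \<sigma>1: "continuous_map ?P euclideanreal (\<lambda>p. \<sigma> (fst p))"
    and s1: "continuous_map ?P euclideanreal (\<lambda>p. s (fst p))"
    using continuous_map_compose[OF continuous_map_fst \<sigma>(1)]
      continuous_map_compose[OF continuous_map_fst s(1)] by (auto simp: o_def)
  have x1: "continuous_map ?P euclidean (\<lambda>p. snd p)"
    using continuous_map_into_fulltopology[OF continuous_map_snd] by auto
  have "continuous_map ?P (top_of_set (ball 0 1)) (\<lambda>p. (s (fst p) * \<sigma> (fst p)) *\<^sub>R snd p)"
  proof (rule continuous_map_into_subtopology)
    show "continuous_map ?P euclidean (\<lambda>p. (s (fst p) * \<sigma> (fst p)) *\<^sub>R snd p)"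
      by (intro continuous_map_scaleR continuous_map_real_mult \<sigma>1 s1 x1)
    show "(\<lambda>p. (s (fst p) * \<sigma> (fst p)) *\<^sub>R snd p) \<in> topspace ?P \<rightarrow> ball 0 1"
    proof
      fix p assume "p \<in> topspace ?P"
      then have "fst p \<in> topspace Z" "snd p \<in> ball 0 1" by auto
      moreover from this have "0 \<le> s (fst p) * \<sigma> (fst p)" "s (fst p) * \<sigma> (fst p) \<le> 1"
        using \<sigma>(2)[of "fst p"] s(2)[of "fst p"] by (simp_all add: mult_le_one less_imp_le)
      ultimately show "(s (fst p) * \<sigma> (fst p)) *\<^sub>R snd p \<in> ball 0 1"
        by (intro scale_in_ball)
    qed
  qed
  then have "continuous_map ?P ?P (\<lambda>p. (fst p, (s (fst p) * \<sigma> (fst p)) *\<^sub>R snd p))"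
    by (intro continuous_map_pairedI continuous_map_fst)
  then have inner: "continuous_map ?P euclidean
      (\<lambda>p. iter_deriv vs (\<lambda>y. F (fst p) (i, y)) ((s (fst p) * \<sigma> (fst p)) *\<^sub>R snd p))" for vs
    using continuous_map_compose[of ?P ?P _ euclidean "\<lambda>(z, x). iter_deriv vs (\<lambda>y. F z (i, y)) x"]
      F i by (fastforce simp: jointly_smooth_def o_def)
  have zd: "continuous_map ?P euclidean (\<lambda>(z, x). ?zd vs z x)" for vs
    using continuous_map_scaleR[OF continuous_map_real_mult[OF continuous_map_real_pow[OF s1]
          continuous_map_real_pow[OF \<sigma>1]] inner]
    by (simp add: zoom_deriv_def case_prod_unfold)
  show "continuous_map ?P euclidean (\<lambda>(z, x). iter_deriv vs (?zoom z) x)"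
  proof (cases "vs = []")
    case False
    show ?thesis
    proof (rule continuous_map_eq[OF zd[of vs]])
      fix p assume "p \<in> topspace ?P"
      then have "fst p \<in> topspace Z" "snd p \<in> ball 0 1" by auto
      then show "(case p of (z, x) \<Rightarrow> ?zd vs z x) = (case p of (z, x) \<Rightarrow> iter_deriv vs (?zoom z) x)"
        using zoom_derivatives(2)[OF Fz i _ _ _ _ False, of "fst p" "\<sigma> (fst p)" "s (fst p)" "snd p"]
          \<sigma>(2)[of "fst p"] s(2)[of "fst p"] by (simp add: case_prod_unfold)
    qed
  next
    case True
    have "continuous_map ?P euclidean (\<lambda>(z, x). ?zoom z x)"
    proof (rule joint_continuity_from_derivative)
      fix z x assume z: "z \<in> topspace Z" and x: "x \<in> ball (0::'a) 1"
      have "(?zoom z has_derivative (\<lambda>v. iter_deriv [v] (?zoom z) x)) (at x)"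
        using smooth_on_has_derivative[OF zoom_derivatives(1)[OF Fz[OF z] i] x, of "\<sigma> z" "s z" "[]"]
          \<sigma>(2)[OF z] s(2)[OF z] by simp
      moreover have "iter_deriv [v] (?zoom z) x = ?zd [v] z x" for v
        using zoom_derivatives(2)[OF Fz[OF z] i _ _ _ _ _ x, of "\<sigma> z" "s z" "[v]"]
          \<sigma>(2)[OF z] s(2)[OF z] by blast
      ultimately show "(?zoom z has_derivative (\<lambda>v. ?zd [v] z x)) (at x)"
        by (simp only:)
    next
      show "continuous_map ?P euclidean (\<lambda>(z, x). ?zd [v] z x)" for v by (rule zd)
    next
      have "continuous_map Z ?P (\<lambda>z. (z, 0))"
        by (intro continuous_map_pairedI) auto
      moreover have "continuous_map ?P euclidean (\<lambda>(z, x). iter_deriv [] (\<lambda>y. F z (i, y)) x)"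
        using F i unfolding jointly_smooth_def by blast
      ultimately have "continuous_map Z euclidean ((\<lambda>(z, x). iter_deriv [] (\<lambda>y. F z (i, y)) x) \<circ> (\<lambda>z. (z, 0)))"
        by (rule continuous_map_compose)
      then have "continuous_map Z euclidean (\<lambda>z. F z (i, 0))" by (simp add: o_def)
      then show "continuous_map Z euclidean (\<lambda>z. ?zoom z 0)"
        by (rule continuous_map_eq) (use zoom_at_0[OF Fz i] \<sigma>(2) s(2) in simp)
    qed
    then show ?thesis by (simp add: True)
  qed
qed

section \<open>Rescaled maps that are r-immersions\<close>

lemma discsE:
  assumes "p \<in> discs k"
  obtains i x where "p = (i, x)" "i \<in> {1..k}" "x \<in> ball 0 1"
  using assms unfolding discs_def by (rule SigmaE) (rule that)

text \<open>
  Shrinking the discs is precomposition with an injective immersion.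
\<close>

lemma zoom_1_r_immersion:
  assumes f: "f \<in> r_immersions r k" and \<sigma>: "0 < \<sigma>" "\<sigma> \<le> 1"
  shows "zoom k \<sigma> 1 f \<in> r_immersions r k"
  unfolding r_immersions_def
proof (intro CollectI conjI ballI allI)
  have inj: "inj (frechet_derivative (\<lambda>y. f (i, y)) (at x))" if "(i, x) \<in> discs k" for i x
    using f that by (auto simp: r_immersions_def)
  have fs: "f \<in> smooth_maps k" using f by (simp add: r_immersions_def)
  show "zoom k \<sigma> 1 f \<in> smooth_maps k" using fs \<sigma> by (simp add: zoom_smooth_maps)
  show "case p of (i, x) \<Rightarrow> inj (frechet_derivative (\<lambda>y. zoom k \<sigma> 1 f (i, y)) (at x))"
    if pd: "p \<in> discs k" for p
  proof -
    obtain i x where p: "p = (i, x)" "i \<in> {1..k}" "x \<in> ball 0 1" using pd by (rule discsE)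
    have "(i, (1 * \<sigma>) *\<^sub>R x) \<in> discs k"
      using p \<sigma> scale_in_ball[of \<sigma> x 1] by (simp add: discs_def)
    from inj[OF this] show ?thesis
      using \<sigma> by (simp add: p zoom_frechet_derivative[OF fs p(2) _ _ _ _ p(3)] inj_def)
  qed
  fix z
  let ?S = "{p \<in> discs k. zoom k \<sigma> 1 f p = z}" and ?T = "{p \<in> discs k. f p = z}"
  let ?h = "\<lambda>(i, x). (i, \<sigma> *\<^sub>R x)"
  have sub: "?h ` ?S \<subseteq> ?T"
    using \<sigma> scale_in_ball[of \<sigma> _ 1] by (force simp: discs_def zoom_def)
  have inj_h: "inj_on ?h ?S" using \<sigma> by (auto simp: inj_on_def)
  have T: "finite ?T" "card ?T < r" using f by (auto simp: r_immersions_def)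
  show "finite ?S" by (rule inj_on_finite[OF inj_h sub T(1)])
  show "card ?S < r" using card_inj_on_le[OF inj_h sub T(1)] T(2) by linarith
qed

definition no_r_equal :: "nat \<Rightarrow> nat \<Rightarrow> (nat \<Rightarrow> 'b) \<Rightarrow> bool"
  where "no_r_equal r k x \<longleftrightarrow> \<not> (\<exists>I\<subseteq>{1..k}. card I = r \<and> (\<forall>i\<in>I. \<forall>j\<in>I. x i = x j))"

text \<open>
  Two things can go wrong when magnifying: a disc may meet itself, and images of different discs may
  grow into each other. The first is excluded if \<open>f\<close> embeds the small discs, because then each disc
  meets a fibre at most once. For the second, all images stay within \<open>\<delta>\<close> of the centres \<open>f (i, 0)\<close>,
  uniformly in \<open>s\<close> because the magnification is compensated by the linear bound \<open>M\<close>; and \<open>r\<close>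
  centres never all lie within \<open>\<delta>\<close> of one point.
\<close>

lemma zoom_r_immersion:
  assumes f: "f \<in> smooth_maps k" and \<tau>: "0 < \<tau>" "\<tau> \<le> 1" and s: "0 \<le> s" "s \<le> 1"
    and imm: "\<And>i x. i \<in> {1..k} \<Longrightarrow> x \<in> ball 0 \<tau> \<Longrightarrow> inj (frechet_derivative (\<lambda>y. f (i, y)) (at x))"
    and emb: "\<And>i. i \<in> {1..k} \<Longrightarrow> inj_on (\<lambda>y. f (i, y)) (ball 0 \<tau>)"
    and M: "\<And>i x. i \<in> {1..k} \<Longrightarrow> x \<in> ball 0 \<tau> \<Longrightarrow> norm (f (i, x) - f (i, 0)) \<le> M * norm x"
    and M': "\<And>i x. i \<in> {1..k} \<Longrightarrow> norm (frechet_derivative (\<lambda>y. f (i, y)) (at 0) x) \<le> M * norm x"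
    and "0 < M" "M * \<tau> \<le> \<delta>"
    and sep: "\<And>I. I \<subseteq> {1..k} \<Longrightarrow> card I = r \<Longrightarrow> \<exists>i\<in>I. \<exists>j\<in>I. 2 * \<delta> \<le> norm (f (i, 0) - f (j, 0))"
  shows "zoom k \<tau> s f \<in> r_immersions r k"
  unfolding r_immersions_def
proof (intro CollectI conjI ballI allI)
  show "zoom k \<tau> s f \<in> smooth_maps k" using f \<tau> s by (simp add: zoom_smooth_maps)
  have s\<tau>: "(s * \<tau>) *\<^sub>R x \<in> ball 0 \<tau>" if "x \<in> ball (0::'a) 1" for x
  proof -
    have "\<tau> *\<^sub>R x \<in> ball 0 \<tau>" using that \<tau> by simp
    from scale_in_ball[OF s this] show ?thesis by simp
  qed
  show "case p of (i, x) \<Rightarrow> inj (frechet_derivative (\<lambda>y. zoom k \<tau> s f (i, y)) (at x))"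
    if pd: "p \<in> discs k" for p
  proof -
    obtain i x where p: "p = (i, x)" "i \<in> {1..k}" "x \<in> ball 0 1" using pd by (rule discsE)
    from imm[OF p(2) s\<tau>[OF p(3)]] show ?thesis
      using \<tau> by (simp add: p zoom_frechet_derivative[OF f p(2) \<tau> s p(3)] inj_def)
  qed
  have inj: "x = y" if "i \<in> {1..k}" "x \<in> ball 0 1" "y \<in> ball 0 1"
    "zoom k \<tau> s f (i, x) = zoom k \<tau> s f (i, y)" for i x y
  proof (cases "s = 0")
    case True
    have "(i, x) \<in> discs k" "(i, y) \<in> discs k" using that by (auto simp: discs_def)
    then have "frechet_derivative (\<lambda>y. f (i, y)) (at 0) x = frechet_derivative (\<lambda>y. f (i, y)) (at 0) y"
      using that \<tau> by (simp add: zoom_def True)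
    then show ?thesis using imm[OF that(1), of 0] \<tau> by (simp add: inj_def)
  next
    case False
    have "(i, x) \<in> discs k" "(i, y) \<in> discs k" using that by (auto simp: discs_def)
    then have "f (i, (s * \<tau>) *\<^sub>R x) = f (i, (s * \<tau>) *\<^sub>R y)"
      using that False by (simp add: zoom_def)
    from inj_onD[OF emb[OF that(1)] this s\<tau>[OF that(2)] s\<tau>[OF that(3)]]
    show ?thesis using False \<tau> by simp
  qed
  have close: "norm (zoom k \<tau> s f (i, x) - f (i, 0)) < \<delta>" if i: "i \<in> {1..k}" and x: "x \<in> ball 0 1" for i x
  proof -
    have "(i, x) \<in> discs k" using that by (auto simp: discs_def)
    have "norm (zoom k \<tau> s f (i, x) - f (i, 0)) \<le> M * \<tau> * norm x"
    proof (cases "s = 0")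
      case True
      have "\<tau> * norm (frechet_derivative (\<lambda>y. f (i, y)) (at 0) x) \<le> \<tau> * (M * norm x)"
        using M'[OF i, of x] \<tau> by (intro mult_left_mono) auto
      then show ?thesis
        using \<open>(i, x) \<in> discs k\<close> \<tau> by (simp add: zoom_def True mult_ac)
    next
      case False
      have "norm (f (i, (s * \<tau>) *\<^sub>R x) - f (i, 0)) \<le> M * norm ((s * \<tau>) *\<^sub>R x)"
        by (rule M[OF i s\<tau>[OF x]])
      then have "norm (f (i, (s * \<tau>) *\<^sub>R x) - f (i, 0)) / s \<le> M * norm ((s * \<tau>) *\<^sub>R x) / s"
        using s by (intro divide_right_mono)
      moreover have "norm (zoom k \<tau> s f (i, x) - f (i, 0)) = norm (f (i, (s * \<tau>) *\<^sub>R x) - f (i, 0)) / s"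
        using \<open>(i, x) \<in> discs k\<close> False s by (simp add: zoom_def divide_inverse mult.commute)
      ultimately show ?thesis using \<tau> False s by simp
    qed
    also have "\<dots> < M * \<tau> * 1"
      using x \<tau> \<open>0 < M\<close> by (intro mult_strict_left_mono) auto
    finally show ?thesis using \<open>M * \<tau> \<le> \<delta>\<close> by simp
  qed
  fix z
  let ?S = "{p \<in> discs k. zoom k \<tau> s f p = z}"
  have fst_inj: "inj_on fst ?S" using inj by (fastforce simp: inj_on_def discs_def)
  have fst_sub: "fst ` ?S \<subseteq> {1..k}" by (auto simp: discs_def)
  show "finite ?S" using fst_inj fst_sub by (meson finite_atLeastAtMost inj_on_finite)
  show "card ?S < r"
  proof (rule ccontr)
    assume "\<not> card ?S < r"
    then have "r \<le> card (fst ` ?S)" using fst_inj by (simp add: card_image)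
    then obtain I where I: "I \<subseteq> fst ` ?S" "card I = r" by (meson obtain_subset_with_card_n)
    then obtain i j where ij: "i \<in> I" "j \<in> I" "2 * \<delta> \<le> norm (f (i, 0) - f (j, 0))"
      using sep[of I] fst_sub by blast
    have near: "norm (z - f (i, 0)) < \<delta>" if "i \<in> I" for i
      using I that close by (force simp: discs_def)
    have "norm (f (i, 0) - f (j, 0)) \<le> norm (z - f (i, 0)) + norm (z - f (j, 0))"
      using norm_triangle_ineq4[of "z - f (j, 0)" "z - f (i, 0)"] by simp
    then show False using near[OF ij(1)] near[OF ij(2)] ij(3) by simp
  qed
qed

lemma finite_positive_lower_bound:
  fixes g :: "'i \<Rightarrow> real"
  assumes "finite S" "\<And>i. i \<in> S \<Longrightarrow> 0 < g i"
  obtains d where "0 < d" "\<And>i. i \<in> S \<Longrightarrow> d \<le> g i"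
proof (rule that)
  show "0 < Min (insert 1 (g ` S))" using assms by simp
  show "Min (insert 1 (g ` S)) \<le> g i" if "i \<in> S" for i using assms that by (intro Min_le) auto
qed

text \<open>
  The distances of distinct points of a finite configuration have a positive minimum, and any \<open>r\<close>
  indices include two distinct points. The factor 4 leaves room for moving both points by \<open>\<delta>\<close>.
\<close>

lemma no_r_equal_separated:
  fixes c :: "nat \<Rightarrow> 'b::real_normed_vector"
  assumes "no_r_equal r k c"
  obtains \<delta> where "0 < \<delta>"
    "\<And>I. I \<subseteq> {1..k} \<Longrightarrow> card I = r \<Longrightarrow> \<exists>i\<in>I. \<exists>j\<in>I. 4 * \<delta> \<le> norm (c i - c j)"
proof -
  let ?S = "{(i, j). i \<in> {1..k} \<and> j \<in> {1..k} \<and> c i \<noteq> c j}"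
  have "finite ?S" by (rule finite_subset[of _ "{1..k} \<times> {1..k}"]) auto
  then obtain d where d: "0 < d" "\<And>p. p \<in> ?S \<Longrightarrow> d \<le> norm (c (fst p) - c (snd p))"
    by (rule finite_positive_lower_bound[of ?S "\<lambda>p. norm (c (fst p) - c (snd p))"]) auto
  show ?thesis
  proof (rule that[of "d/4"])
    fix I assume I: "I \<subseteq> {1..k}" "card I = r"
    then obtain i j where ij: "i \<in> I" "j \<in> I" "c i \<noteq> c j"
      using assms unfolding no_r_equal_def by blast
    then have "(i, j) \<in> ?S" using I by blast
    from d(2)[OF this] have "d \<le> norm (c i - c j)" by simp
    with ij show "\<exists>i\<in>I. \<exists>j\<in>I. 4 * (d/4) \<le> norm (c i - c j)" by auto
  qed (use d in simp)
qed

text \<open>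
  The hypotheses concern only the centres at the single parameter \<open>z0\<close>. Injectivity of the
  derivative is an open condition with a quantitative form: \<open>L\<close> stretches vectors by at least \<open>\<mu>\<close>, and
  derivatives within \<open>\<mu>/4\<close> of \<open>L\<close> on a small ball force the map to be an embedded immersion there.
  Joint continuity provides such a ball for all nearby parameters at once.
\<close>

lemma zoom_r_immersion_locally:
  fixes F :: "'z \<Rightarrow> nat \<times> 'a::fin_dim_inner \<Rightarrow> 'b::real_normed_vector"
  assumes F: "jointly_smooth Z k F" and z0: "z0 \<in> topspace Z"
    and conf: "no_r_equal r k (\<lambda>i. F z0 (i, 0))"
    and inj: "\<And>i. i \<in> {1..k} \<Longrightarrow> inj (frechet_derivative (\<lambda>y. F z0 (i, y)) (at 0))"
  shows "\<exists>U \<tau>. openin Z U \<and> z0 \<in> U \<and> 0 < \<tau> \<and> \<tau> \<le> 1 \<and>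
    (\<forall>z\<in>U. \<forall>\<tau>' s. 0 < \<tau>' \<longrightarrow> \<tau>' \<le> \<tau> \<longrightarrow> 0 \<le> s \<longrightarrow> s \<le> 1 \<longrightarrow> zoom k \<tau>' s (F z) \<in> r_immersions r k)"
proof -
  let ?P = "prod_topology Z (top_of_set (ball (0::'a) 1))"
  define L where "L i = frechet_derivative (\<lambda>y. F z0 (i, y)) (at 0)" for i
  have Fz: "F z \<in> smooth_maps k" if "z \<in> topspace Z" for z
    using F that by (simp add: jointly_smooth_def)
  have der: "((\<lambda>y. F z (i, y)) has_derivative frechet_derivative (\<lambda>y. F z (i, y)) (at x)) (at x)"
    if "z \<in> topspace Z" "i \<in> {1..k}" "x \<in> ball 0 1" for z i x
    using smooth_on_has_derivative[OF smooth_maps_smooth_on[OF Fz[OF that(1)] that(2)] that(3), of "[]"]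
    by simp
  have linL: "linear (L i)" if "i \<in> {1..k}" for i
    using has_derivative_linear[OF der[OF z0 that, of 0]] by (simp add: L_def)
  have "\<exists>\<mu>>0. \<forall>v. \<mu> * norm v \<le> norm (L i v)" if "i \<in> {1..k}" for i
    using inj_linear_bounded_below[OF linL[OF that]] inj[OF that] unfolding L_def by metis
  then obtain m where m: "\<And>i. i \<in> {1..k} \<Longrightarrow> 0 < m i"
    "\<And>i v. i \<in> {1..k} \<Longrightarrow> m i * norm v \<le> norm (L i v)" by metis
  obtain \<mu> where \<mu>: "0 < \<mu>" "\<And>i. i \<in> {1..k} \<Longrightarrow> \<mu> \<le> m i"
    using finite_positive_lower_bound[of "{1..k}" m] m(1) by blast
  have L_lower: "\<mu> * norm v \<le> norm (L i v)" if "i \<in> {1..k}" for i v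
    using mult_right_mono[OF \<mu>(2)[OF that] norm_ge_zero[of v]] m(2)[OF that, of v] by linarith
  obtain \<delta> where \<delta>: "0 < \<delta>"
    "\<And>I. I \<subseteq> {1..k} \<Longrightarrow> card I = r \<Longrightarrow> \<exists>i\<in>I. \<exists>j\<in>I. 4 * \<delta> \<le> norm (F z0 (i, 0) - F z0 (j, 0))"
    using no_r_equal_separated[OF conf] by blast
  define D where "D i p = (\<Sum>b\<in>onb. norm (frechet_derivative (\<lambda>y. F (fst p) (i, y)) (at (snd p)) b - L i b))"
    for i and p :: "'z \<times> 'a"
  define Q where "Q i U \<epsilon> \<longleftrightarrow> openin Z U \<and> z0 \<in> U \<and> 0 < \<epsilon> \<and> \<epsilon> \<le> 1 \<and>
      (\<forall>z\<in>U. \<forall>x\<in>ball 0 \<epsilon>. D i (z, x) < \<mu>/4) \<and> (\<forall>z\<in>U. norm (F z (i, 0) - F z0 (i, 0)) < \<delta>)"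
    for i U \<epsilon>
  have "\<exists>U \<epsilon>. Q i U \<epsilon>" if i: "i \<in> {1..k}" for i
  proof -
    have cont: "continuous_map ?P euclidean (\<lambda>p. iter_deriv vs (\<lambda>y. F (fst p) (i, y)) (snd p))" for vs
      using F i unfolding jointly_smooth_def by (simp add: case_prod_unfold)
    have "continuous_map ?P euclideanreal (D i)"
      unfolding D_def using cont[of "[_]"] by (intro continuous_intros finite_onb) simp
    then have "openin ?P {p \<in> topspace ?P. D i p \<in> {..<\<mu>/4}}"
      by (rule openin_continuous_map_preimage) simp
    moreover have "(z0, 0) \<in> {p \<in> topspace ?P. D i p \<in> {..<\<mu>/4}}"
      using z0 \<mu> by (simp add: D_def L_def)
    ultimately have "\<exists>U V. openin Z U \<and> openin (top_of_set (ball 0 1)) V \<and> z0 \<in> U \<and> 0 \<in> V \<and>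
        U \<times> V \<subseteq> {p \<in> topspace ?P. D i p \<in> {..<\<mu>/4}}"
      by (simp only: openin_prod_topology_alt)
    then obtain U V where UV: "openin Z U" "openin (top_of_set (ball 0 1)) V" "z0 \<in> U" "0 \<in> V"
      "U \<times> V \<subseteq> {p \<in> topspace ?P. D i p \<in> {..<\<mu>/4}}"
      by (elim exE conjE)
    have "open V" using UV(2) openin_open_trans by blast
    then obtain \<epsilon> where \<epsilon>: "\<epsilon> > 0" "ball 0 \<epsilon> \<subseteq> V" using UV(4) open_contains_ball by blast
    have "continuous_map Z ?P (\<lambda>z. (z, 0))" by (intro continuous_map_pairedI) auto
    from continuous_map_compose[OF this cont[of "[]"]]
    have "continuous_map Z euclidean (\<lambda>z. F z (i, 0))" by (simp add: o_def)
    then have W: "openin Z {z \<in> topspace Z. F z (i, 0) \<in> ball (F z0 (i, 0)) \<delta>}"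
      by (rule openin_continuous_map_preimage) simp
    let ?W = "{z \<in> topspace Z. F z (i, 0) \<in> ball (F z0 (i, 0)) \<delta>}"
    show ?thesis
      unfolding Q_def
    proof (intro exI[of _ "U \<inter> ?W"] exI[of _ "min \<epsilon> 1"] conjI ballI)
      show "openin Z (U \<inter> ?W)" using UV(1) W by (rule openin_Int)
      show "z0 \<in> U \<inter> ?W" using UV(3) z0 \<delta>(1) by simp
      show "0 < min \<epsilon> 1" "min \<epsilon> 1 \<le> 1" using \<epsilon>(1) by auto
      show "D i (z, x) < \<mu>/4" if "z \<in> U \<inter> ?W" "x \<in> ball 0 (min \<epsilon> 1)" for z x
      proof -
        have "(z, x) \<in> U \<times> V" using that \<epsilon>(2) by auto
        from subsetD[OF UV(5) this] show ?thesis by simp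
      qed
      show "norm (F z (i, 0) - F z0 (i, 0)) < \<delta>" if "z \<in> U \<inter> ?W" for z
        using that by (simp add: dist_norm norm_minus_commute)
    qed
  qed
  then obtain U \<epsilon> where "\<And>i. i \<in> {1..k} \<Longrightarrow> Q i (U i) (\<epsilon> i)" by metis
  then have U: "\<And>i. i \<in> {1..k} \<Longrightarrow> openin Z (U i)" "\<And>i. i \<in> {1..k} \<Longrightarrow> z0 \<in> U i"
    and \<epsilon>: "\<And>i. i \<in> {1..k} \<Longrightarrow> 0 < \<epsilon> i" "\<And>i. i \<in> {1..k} \<Longrightarrow> \<epsilon> i \<le> 1"
    and D: "\<And>i z x. i \<in> {1..k} \<Longrightarrow> z \<in> U i \<Longrightarrow> x \<in> ball 0 (\<epsilon> i) \<Longrightarrow> D i (z, x) < \<mu>/4"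
    and c: "\<And>i z. i \<in> {1..k} \<Longrightarrow> z \<in> U i \<Longrightarrow> norm (F z (i, 0) - F z0 (i, 0)) < \<delta>"
    unfolding Q_def by blast+
  obtain e where e: "0 < e" "\<And>i. i \<in> {1..k} \<Longrightarrow> e \<le> \<epsilon> i"
    using finite_positive_lower_bound[of "{1..k}" \<epsilon>] \<epsilon>(1) by blast
  \<comment> \<open>A common Lipschitz constant at the centre for all discs and all nearby parameters.\<close>
  define M where "M = (\<Sum>i=1..k. \<Sum>b\<in>onb. norm (L i b)) + \<mu>/4"
  have "0 < M" using \<mu> by (auto simp: M_def intro!: add_nonneg_pos sum_nonneg)
  have LM: "norm (L i v) + \<mu>/4 * norm v \<le> M * norm v" if i: "i \<in> {1..k}" for i v
  proof -
    have "norm (L i v) \<le> norm v * (\<Sum>b\<in>onb. norm (L i b))" by (rule norm_linear_le_onb[OF linL[OF i]])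
    also have "\<dots> \<le> norm v * (\<Sum>i=1..k. \<Sum>b\<in>onb. norm (L i b))"
      using i by (intro mult_left_mono member_le_sum[of i "{1..k}" "\<lambda>i. \<Sum>b\<in>onb. norm (L i b)"])
        (auto intro: sum_nonneg)
    finally show ?thesis by (simp add: M_def algebra_simps)
  qed
  \<comment> \<open>Below \<open>e\<close> the discs are embedded, below \<open>\<delta>/M\<close> their images stay near the centres.\<close>
  define \<tau> where "\<tau> = min 1 (min e (\<delta>/M))"
  have \<tau>: "0 < \<tau>" "\<tau> \<le> 1" "\<tau> \<le> e" "\<tau> \<le> \<delta>/M"
    using e \<delta> \<open>0 < M\<close> by (auto simp: \<tau>_def)
  define V where "V = topspace Z \<inter> (\<Inter>i\<in>{1..k}. U i)"
  have "openin Z V"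
  proof (cases "k = 0")
    case False
    then have "openin Z (\<Inter>i\<in>{1..k}. U i)" using U by (intro openin_INT2) auto
    then show ?thesis unfolding V_def by blast
  qed (simp add: V_def)
  moreover have "z0 \<in> V" using z0 U by (simp add: V_def)
  moreover have "zoom k \<tau>' s (F z) \<in> r_immersions r k"
    if z: "z \<in> V" and \<tau>': "0 < \<tau>'" "\<tau>' \<le> \<tau>" and s: "0 \<le> s" "s \<le> 1" for z \<tau>' s
  proof -
    have zU: "z \<in> U i" if "i \<in> {1..k}" for i using z that by (auto simp: V_def)
    have zZ: "z \<in> topspace Z" using z by (simp add: V_def)
    let ?d = "\<lambda>i x. frechet_derivative (\<lambda>y. F z (i, y)) (at x)"
    have ball1: "ball (0::'a) \<tau>' \<subseteq> ball 0 1" using \<tau> \<tau>' by auto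
    have linear_d: "linear (?d i x)" if "i \<in> {1..k}" "x \<in> ball 0 \<tau>'" for i x
      using der[OF zZ that(1)] that(2) ball1 has_derivative_linear by blast
    have dL: "norm (?d i x v - L i v) \<le> \<mu>/4 * norm v" if i: "i \<in> {1..k}" and x: "x \<in> ball 0 \<tau>'" for i x v
    proof -
      have "norm (?d i x v - L i v) \<le> norm v * (\<Sum>b\<in>onb. norm (?d i x b - L i b))"
        using norm_linear_le_onb[OF linear_compose_sub[OF linear_d[OF i x] linL[OF i]]] .
      also have "(\<Sum>b\<in>onb. norm (?d i x b - L i b)) = D i (z, x)" by (simp add: D_def)
      also have "norm v * D i (z, x) \<le> norm v * (\<mu>/4)"
        using D[OF i zU[OF i], of x] x \<tau> \<tau>' e(2)[OF i] by (intro mult_left_mono) auto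
      finally show ?thesis by (simp add: mult.commute)
    qed
    have inc: "norm (F z (i, x) - F z (i, y) - L i (x - y)) \<le> \<mu>/4 * norm (x - y)"
      if i: "i \<in> {1..k}" and xy: "x \<in> ball 0 \<tau>'" "y \<in> ball 0 \<tau>'" for i x y
    proof -
      have "norm ((F z (i, x) - L i x) - (F z (i, y) - L i y)) \<le> \<mu>/4 * norm (x - y)"
      proof (rule differentiable_bound)
        show "convex (ball (0::'a) \<tau>')" by simp
        fix w :: 'a assume w: "w \<in> ball 0 \<tau>'"
        have "((\<lambda>x. F z (i, x) - L i x) has_derivative (\<lambda>v. ?d i w v - L i v)) (at w)"
          using w ball1 i
          by (intro has_derivative_diff der zZ bounded_linear_imp_has_derivative bounded_linear_fin_dim linL) auto
        then show "((\<lambda>x. F z (i, x) - L i x) has_derivative (\<lambda>v. ?d i w v - L i v)) (at w within ball 0 \<tau>')"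
          by (rule has_derivative_at_withinI)
        show "onorm (\<lambda>v. ?d i w v - L i v) \<le> \<mu>/4"
          using \<mu> by (intro onorm_bound dL i w) simp
      qed (use xy in auto)
      then show ?thesis by (simp add: linear_diff[OF linL[OF i]] algebra_simps)
    qed
    have pinch: "v = 0" if "i \<in> {1..k}" "norm (L i v) \<le> \<mu>/4 * norm v" for i v
    proof -
      have "\<mu> * norm v \<le> \<mu>/4 * norm v" using L_lower[OF that(1), of v] that(2) by linarith
      then have "\<mu> * norm v \<le> 0" by simp
      then show ?thesis using \<mu>(1) by (simp add: mult_le_0_iff)
    qed
    show ?thesis
    proof (rule zoom_r_immersion[where M = M and \<delta> = \<delta>])
      show "inj (?d i x)" if i: "i \<in> {1..k}" and x: "x \<in> ball 0 \<tau>'" for i x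
        unfolding linear_injective_0[OF linear_d[OF i x]]
        using dL[OF i x] pinch[OF i] by (metis diff_0 norm_minus_cancel)
      show "inj_on (\<lambda>y. F z (i, y)) (ball 0 \<tau>')" if i: "i \<in> {1..k}" for i
      proof (rule inj_onI)
        fix x y assume xy: "x \<in> ball 0 \<tau>'" "y \<in> ball 0 \<tau>'" "F z (i, x) = F z (i, y)"
        then have "x - y = 0" using inc[OF i xy(1,2)] by (intro pinch[OF i]) simp
        then show "x = y" by simp
      qed
      show "norm (F z (i, x) - F z (i, 0)) \<le> M * norm x" if i: "i \<in> {1..k}" and x: "x \<in> ball 0 \<tau>'" for i x
        using inc[OF i x, of 0] LM[OF i, of x] \<tau>'
          norm_triangle_ineq[of "F z (i, x) - F z (i, 0) - L i x" "L i x"] by simp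
      show "norm (?d i 0 x) \<le> M * norm x" if i: "i \<in> {1..k}" for i x
        using dL[OF i, of 0 x] LM[OF i, of x] \<tau>' norm_triangle_ineq[of "?d i 0 x - L i x" "L i x"] by simp
      have "M * \<tau> \<le> \<delta>" using \<tau>(4) \<open>0 < M\<close> by (simp add: field_simps)
      moreover have "M * \<tau>' \<le> M * \<tau>" using \<tau>' \<open>0 < M\<close> by simp
      ultimately show "M * \<tau>' \<le> \<delta>" by linarith
      show "\<exists>i\<in>I. \<exists>j\<in>I. 2 * \<delta> \<le> norm (F z (i, 0) - F z (j, 0))" if I: "I \<subseteq> {1..k}" "card I = r" for I
      proof -
        obtain i j where ij: "i \<in> I" "j \<in> I" "4 * \<delta> \<le> norm (F z0 (i, 0) - F z0 (j, 0))"
          using \<delta>(2)[OF I] by blast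
        then have c2: "norm (F z (i, 0) - F z0 (i, 0)) < \<delta>" "norm (F z (j, 0) - F z0 (j, 0)) < \<delta>"
          using I c zU by blast+
        have "norm (a - b) \<le> norm (a' - b') + (norm (a' - a) + norm (b' - b))" for a b a' b' :: 'b
        proof -
          have "a - b = (a' - b') - ((a' - a) - (b' - b))" by simp
          then show ?thesis
            using norm_triangle_ineq4[of "a' - b'" "(a' - a) - (b' - b)"]
              norm_triangle_ineq4[of "a' - a" "b' - b"] by simp
        qed
        from this[of "F z0 (i, 0)" "F z0 (j, 0)" "F z (i, 0)" "F z (j, 0)"]
        have "2 * \<delta> \<le> norm (F z (i, 0) - F z (j, 0))" using c2 ij(3) by linarith
        with ij show ?thesis by blast
      qed
      show "F z \<in> smooth_maps k" by (rule Fz[OF zZ])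
      show "0 < \<tau>'" "\<tau>' \<le> 1" "0 \<le> s" "s \<le> 1" "0 < M"
        using \<tau> \<tau>' s \<open>0 < M\<close> by linarith+
    qed
  qed
  ultimately show ?thesis using \<tau> by blast
qed

section \<open>The evaluation map and affine representatives\<close>

abbreviation (input) target :: "nat \<Rightarrow> nat \<Rightarrow> ((nat \<Rightarrow> 'b::real_normed_vector) \<times> (nat \<Rightarrow> 'a::real_normed_vector \<Rightarrow>\<^sub>L 'b)) topology"
  where "target r k \<equiv> prod_topology (rConf r k) (product_topology (\<lambda>_. Linj) {1..k})"

lemma topspace_rConf:
  "topspace (rConf r k) = {x \<in> extensional {1..k}. no_r_equal r k x}"
proof -
  have "topspace (rConf r k) = extensional {1..k} \<inter> {x. no_r_equal r k x}"
    unfolding rConf_def no_r_equal_def by (simp add: PiE_def)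
  then show ?thesis by (simp only: Int_def mem_Collect_eq)
qed

lemma topspace_Linj: "topspace Linj = {A. inj (blinfun_apply A)}"
  by (simp add: Linj_def)

lemma in_target_iff:
  "y \<in> topspace (target r k) \<longleftrightarrow>
    fst y \<in> extensional {1..k} \<and> no_r_equal r k (fst y) \<and>
    snd y \<in> extensional {1..k} \<and> (\<forall>i\<in>{1..k}. inj (blinfun_apply (snd y i)))"
  by (simp add: topspace_rConf topspace_Linj mem_Times_iff PiE_iff conj_ac del: atLeastAtMost_iff)

lemma continuous_map_targetI:
  assumes "\<And>i. i \<in> {1..k} \<Longrightarrow> continuous_map Z euclidean (\<lambda>z. fst (g z) i)"
    and "\<And>i. i \<in> {1..k} \<Longrightarrow> continuous_map Z euclidean (\<lambda>z. snd (g z) i)"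
    and g: "\<And>z. z \<in> topspace Z \<Longrightarrow> g z \<in> topspace (target r k)"
  shows "continuous_map Z (target r k) g"
proof -
  have "continuous_map Z (rConf r k) (fst \<circ> g)"
    unfolding rConf_def continuous_map_in_subtopology
  proof (intro conjI continuous_map_coordinatewise_then_product)
    show "continuous_map Z euclidean (\<lambda>z. (fst \<circ> g) z i)" if "i \<in> {1..k}" for i
      using assms(1)[OF that] by simp
    show "(fst \<circ> g) z i = undefined" if "i \<notin> {1..k}" "z \<in> topspace Z" for i z
      using extensional_arb[OF _ that(1), of "fst (g z)"] g[OF that(2)] unfolding in_target_iff o_apply by blast
    show "fst \<circ> g \<in> topspace Z \<rightarrow> {x. \<not> (\<exists>I\<subseteq>{1..k}. card I = r \<and> (\<forall>i\<in>I. \<forall>j\<in>I. x i = x j))}"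
      using g unfolding in_target_iff no_r_equal_def[symmetric] by simp
  qed
  moreover have "continuous_map Z (product_topology (\<lambda>_. Linj) {1..k}) (snd \<circ> g)"
  proof (intro continuous_map_coordinatewise_then_product)
    show "continuous_map Z Linj (\<lambda>z. (snd \<circ> g) z i)" if "i \<in> {1..k}" for i
      unfolding Linj_def continuous_map_in_subtopology
      using assms(2)[OF that] g that unfolding in_target_iff by simp
    show "(snd \<circ> g) z i = undefined" if "i \<notin> {1..k}" "z \<in> topspace Z" for i z
      using extensional_arb[OF _ that(1), of "snd (g z)"] g[OF that(2)] unfolding in_target_iff o_apply by blast
  qed
  ultimately show ?thesis by (simp add: continuous_map_pairwise)
qed

lemma continuous_map_targetD:
  assumes "continuous_map Z (target r k) g"
  shows "i \<in> {1..k} \<Longrightarrow> continuous_map Z euclidean (\<lambda>z. fst (g z) i)"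
    and "i \<in> {1..k} \<Longrightarrow> continuous_map Z euclidean (\<lambda>z. snd (g z) i)"
    and "z \<in> topspace Z \<Longrightarrow> g z \<in> topspace (target r k)"
proof -
  have 1: "continuous_map Z (rConf r k) (fst \<circ> g)"
    and 2: "continuous_map Z (product_topology (\<lambda>_. Linj) {1..k}) (snd \<circ> g)"
    using assms by (simp_all add: continuous_map_pairwise)
  show "continuous_map Z euclidean (\<lambda>z. fst (g z) i)" if "i \<in> {1..k}"
    using continuous_map_compose[OF continuous_map_into_fulltopology[OF 1[unfolded rConf_def]]
        continuous_map_product_projection[OF that]] by (simp add: o_def)
  show "continuous_map Z euclidean (\<lambda>z. snd (g z) i)" if "i \<in> {1..k}"
    using continuous_map_into_fulltopology[of Z euclidean "{A. inj (blinfun_apply A)}" "\<lambda>z. snd (g z) i"]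
      continuous_map_compose[OF 2 continuous_map_product_projection[OF that]]
    by (simp add: o_def Linj_def)
  show "g z \<in> topspace (target r k)" if "z \<in> topspace Z"
    using continuous_map_image_subset_topspace[OF assms] that by blast
qed

text \<open>
  Rescaling a map by \<open>\<sigma>\<close> changes its image under evaluation by this operation. Multiplication by
  positive scalars is homotopic to the identity, so the discrepancy is harmless.
\<close>

definition scale_target ::
    "nat \<Rightarrow> real \<Rightarrow> (nat \<Rightarrow> 'b) \<times> (nat \<Rightarrow> 'a::real_normed_vector \<Rightarrow>\<^sub>L 'b::real_normed_vector) \<Rightarrow>
      (nat \<Rightarrow> 'b) \<times> (nat \<Rightarrow> 'a \<Rightarrow>\<^sub>L 'b)"
  where "scale_target k l y = (fst y, \<lambda>i\<in>{1..k}. l *\<^sub>R snd y i)"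

lemma scale_target_in_target:
  assumes "y \<in> topspace (target r k)" "l \<noteq> 0"
  shows "scale_target k l y \<in> topspace (target r k)"
  using assms unfolding in_target_iff
  by (auto simp: scale_target_def scaleR_blinfun.rep_eq inj_def)

lemma scale_target_1: "y \<in> topspace (target r k) \<Longrightarrow> scale_target k 1 y = y"
  unfolding in_target_iff by (simp add: scale_target_def extensional_restrict prod_eq_iff)

lemma continuous_map_scale_target:
  assumes l: "continuous_map Z euclideanreal l" "\<And>z. z \<in> topspace Z \<Longrightarrow> l z \<noteq> 0"
    and g: "continuous_map Z (target r k) g"
  shows "continuous_map Z (target r k) (\<lambda>z. scale_target k (l z) (g z))"
proof (rule continuous_map_targetI)
  show "continuous_map Z euclidean (\<lambda>z. fst (scale_target k (l z) (g z)) i)" if "i \<in> {1..k}" for i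
    using continuous_map_targetD(1)[OF g that] by (simp add: scale_target_def)
  show "continuous_map Z euclidean (\<lambda>z. snd (scale_target k (l z) (g z)) i)" if "i \<in> {1..k}" for i
    using continuous_map_scaleR[OF l(1) continuous_map_targetD(2)[OF g that]] that
    by (simp add: scale_target_def)
  show "scale_target k (l z) (g z) \<in> topspace (target r k)" if "z \<in> topspace Z" for z
    using continuous_map_targetD(3)[OF g that] l(2)[OF that] by (rule scale_target_in_target)
qed

text \<open>
  The section of the evaluation map on the level of smooth maps. It need not be an r-immersion until
  its linear part is scaled down.
\<close>

definition affine_map ::
    "nat \<Rightarrow> (nat \<Rightarrow> 'b) \<times> (nat \<Rightarrow> 'a::real_normed_vector \<Rightarrow>\<^sub>L 'b::real_normed_vector) \<Rightarrow> nat \<times> 'a \<Rightarrow> 'b"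
  where "affine_map k y = restrict (\<lambda>(i, x). fst y i + blinfun_apply (snd y i) x) (discs k)"

lemma affine_map_iter_deriv:
  assumes i: "i \<in> {1..k}"
  shows "smooth_on (ball 0 1) (\<lambda>x. affine_map k y (i, x))"
    and "x \<in> ball 0 1 \<Longrightarrow> iter_deriv vs (\<lambda>x. affine_map k y (i, x)) x =
      (case vs of [] \<Rightarrow> fst y i + snd y i x | [v] \<Rightarrow> snd y i v | _ \<Rightarrow> 0)"
proof -
  define D where "D vs x = (case vs of [] \<Rightarrow> fst y i + snd y i x | [v] \<Rightarrow> snd y i v | _ \<Rightarrow> 0)" for vs x
  have base: "affine_map k y (i, x) = D [] x" if "x \<in> ball 0 1" for x
    using that i by (simp add: affine_map_def discs_def D_def)
  have "((\<lambda>x. fst y i + snd y i x) has_derivative (\<lambda>v. 0 + snd y i v)) (at x)" for x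
    by (intro derivative_intros bounded_linear_imp_has_derivative blinfun.bounded_linear_right)
  then have step: "(D vs has_derivative (\<lambda>v. D (v # vs) x)) (at x)" if "x \<in> ball 0 1" for vs x
    by (cases vs) (auto simp: D_def[abs_def] split: list.split)
  show "smooth_on (ball 0 1) (\<lambda>x. affine_map k y (i, x))"
    by (rule iter_deriv_unique(1)[OF open_ball base step])
  show "iter_deriv vs (\<lambda>x. affine_map k y (i, x)) x =
      (case vs of [] \<Rightarrow> fst y i + snd y i x | [v] \<Rightarrow> snd y i v | _ \<Rightarrow> 0)" if "x \<in> ball 0 1"
    using iter_deriv_unique(2)[of "ball 0 1" "\<lambda>x. affine_map k y (i, x)" D, OF open_ball base step that]
    by (simp add: D_def)
qed

lemma affine_map_smooth_maps: "affine_map k y \<in> smooth_maps k"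
  unfolding smooth_maps_def
proof (intro CollectI conjI ballI affine_map_iter_deriv(1))
  show "affine_map k y \<in> extensional (discs k)" by (simp add: affine_map_def)
qed

lemma affine_map_at_0:
  assumes i: "i \<in> {1..k}"
  shows "affine_map k y (i, 0) = fst y i"
    and "frechet_derivative (\<lambda>x. affine_map k y (i, x)) (at 0) = blinfun_apply (snd y i)"
proof -
  show "affine_map k y (i, 0) = fst y i"
    using affine_map_iter_deriv(2)[OF i, of 0 "[]"] by simp
  show "frechet_derivative (\<lambda>x. affine_map k y (i, x)) (at 0) = blinfun_apply (snd y i)"
  proof
    show "frechet_derivative (\<lambda>x. affine_map k y (i, x)) (at 0) v = blinfun_apply (snd y i) v" for v
      using affine_map_iter_deriv(2)[OF i, of 0 "[v]" y] by simp
  qed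
qed

lemma ev_affine_map: "y \<in> topspace (target r k) \<Longrightarrow> ev k (affine_map k y) = y"
  unfolding in_target_iff
  by (cases y) (auto simp: ev_def affine_map_at_0 blinfun_apply_inverse fun_eq_iff extensional_def)

lemma jointly_smooth_affine_map:
  fixes b :: "'z \<Rightarrow> (nat \<Rightarrow> 'b::real_normed_vector) \<times> (nat \<Rightarrow> 'a::real_normed_vector \<Rightarrow>\<^sub>L 'b)"
  assumes b: "continuous_map Z (target r k) b"
  shows "jointly_smooth Z k (\<lambda>z. affine_map k (b z))"
  unfolding jointly_smooth_def
proof (intro conjI ballI allI)
  show "affine_map k (b z) \<in> smooth_maps k" for z by (rule affine_map_smooth_maps)
  fix i and vs :: "'a list" assume i: "i \<in> {1..k}"
  let ?P = "prod_topology Z (top_of_set (ball (0::'a) 1))"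
  have c: "continuous_map ?P euclidean (\<lambda>p. fst (b (fst p)) i)"
    and A: "continuous_map ?P euclidean (\<lambda>p. snd (b (fst p)) i)"
    using continuous_map_compose[OF continuous_map_fst continuous_map_targetD(1)[OF b i]]
      continuous_map_compose[OF continuous_map_fst continuous_map_targetD(2)[OF b i]]
    by (auto simp: o_def)
  have x: "continuous_map ?P euclidean (\<lambda>p. snd p)"
    using continuous_map_into_fulltopology[OF continuous_map_snd] by auto
  have app: "continuous_map ?P euclidean (\<lambda>p. blinfun_apply (snd (b (fst p)) i) (g p))"
    if "continuous_map ?P euclidean g" for g
    using A that by (simp add: continuous_map_atin blinfun.tendsto)
  have "continuous_map ?P euclidean (\<lambda>p. case vs of [] \<Rightarrow> fst (b (fst p)) i + snd (b (fst p)) i (snd p)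
      | [v] \<Rightarrow> snd (b (fst p)) i v | _ \<Rightarrow> 0)"
    using continuous_map_add[OF c app[OF x]] app[of "\<lambda>_. hd vs"]
    by (cases vs rule: remdups_adj.cases) auto
  then show "continuous_map ?P euclidean (\<lambda>(z, x). iter_deriv vs (\<lambda>y. affine_map k (b z) (i, y)) x)"
  proof (rule continuous_map_eq)
    fix p assume "p \<in> topspace ?P"
    then have "snd p \<in> ball 0 1" by auto
    from affine_map_iter_deriv(2)[OF i this, of vs "b (fst p)"]
    show "(case vs of [] \<Rightarrow> fst (b (fst p)) i + snd (b (fst p)) i (snd p)
        | [v] \<Rightarrow> snd (b (fst p)) i v | _ \<Rightarrow> 0) =
      (\<lambda>(z, x). iter_deriv vs (\<lambda>y. affine_map k (b z) (i, y)) x) p"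
      unfolding case_prod_unfold by (rule sym)
  qed
qed

lemma ev_components:
  assumes f: "f \<in> smooth_maps k" and i: "i \<in> {1..k}"
  shows "fst (ev k f) i = f (i, 0)"
    and "blinfun_apply (snd (ev k f) i) = frechet_derivative (\<lambda>x. f (i, x)) (at 0)"
proof -
  have "bounded_linear (frechet_derivative (\<lambda>x. f (i, x)) (at 0))"
    using has_derivative_bounded_linear[OF smooth_on_has_derivative[OF smooth_maps_smooth_on[OF f i], of 0 "[]"]]
    by simp
  then show "blinfun_apply (snd (ev k f) i) = frechet_derivative (\<lambda>x. f (i, x)) (at 0)"
    using i by (simp add: ev_def bounded_linear_Blinfun_apply)
qed (use i in \<open>simp add: ev_def\<close>)

text \<open>
  At \<open>s = 0\<close> the deformation forgets everything except the image under evaluation.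
\<close>

lemma zoom_0_eq_affine_map:
  assumes f: "f \<in> smooth_maps k"
  shows "zoom k \<sigma> 0 f = affine_map k (scale_target k \<sigma> (ev k f))"
proof
  fix p
  show "zoom k \<sigma> 0 f p = affine_map k (scale_target k \<sigma> (ev k f)) p"
  proof (cases "p \<in> discs k")
    case True
    then obtain i x where p: "p = (i, x)" "i \<in> {1..k}" by (rule discsE)
    with True show ?thesis
      by (simp add: zoom_def affine_map_def scale_target_def scaleR_blinfun.rep_eq ev_components[OF f p(2)]
          del: atLeastAtMost_iff)
  qed (simp add: zoom_def affine_map_def)
qed

lemma ev_zoom:
  assumes f: "f \<in> smooth_maps k" and \<sigma>: "0 < \<sigma>" "\<sigma> \<le> 1" and s: "0 \<le> s" "s \<le> 1"
  shows "ev k (zoom k \<sigma> s f) = scale_target k \<sigma> (ev k f)"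
proof -
  have z: "zoom k \<sigma> s f \<in> smooth_maps k" using assms by (rule zoom_smooth_maps)
  have 1: "fst (ev k (zoom k \<sigma> s f)) i = fst (ev k f) i" if "i \<in> {1..k}" for i
    using that by (simp add: ev_components(1)[OF f that] ev_components(1)[OF z that]
        zoom_at_0[OF f that \<sigma> s] del: atLeastAtMost_iff)
  have 2: "snd (ev k (zoom k \<sigma> s f)) i = \<sigma> *\<^sub>R snd (ev k f) i" if "i \<in> {1..k}" for i
    by (rule blinfun_eqI)
      (simp add: ev_components(2)[OF f that] ev_components(2)[OF z that] scaleR_blinfun.rep_eq
        zoom_frechet_derivative[OF f that \<sigma> s])
  have "fst (ev k g) i = undefined" "snd (ev k g) i = undefined" if "i \<notin> {1..k}"
    for i and g :: "nat \<times> 'a \<Rightarrow> 'b"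
    using that by (auto simp: ev_def)
  with 1 2 show ?thesis
    by (simp add: scale_target_def prod_eq_iff fun_eq_iff restrict_def del: atLeastAtMost_iff) metis
qed

text \<open>
  If \<open>r\<close> of the points \<open>f (i, 0)\<close> coincided, their common value would have \<open>r\<close> preimages, namely
  centres of discs.
\<close>

lemma ev_in_target:
  assumes f: "f \<in> r_immersions r k" and r: "0 < r"
  shows "ev k f \<in> topspace (target r k)"
proof -
  have fs: "f \<in> smooth_maps k" using f by (simp add: r_immersions_def)
  have "no_r_equal r k (fst (ev k f))"
    unfolding no_r_equal_def
  proof
    assume "\<exists>I\<subseteq>{1..k}. card I = r \<and> (\<forall>i\<in>I. \<forall>j\<in>I. fst (ev k f) i = fst (ev k f) j)"
    then obtain I where I: "I \<subseteq> {1..k}" "card I = r"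
      and eq: "\<And>i j. i \<in> I \<Longrightarrow> j \<in> I \<Longrightarrow> fst (ev k f) i = fst (ev k f) j" by blast
    obtain i0 where i0: "i0 \<in> I" using I(2) r by fastforce
    have "f (i, 0) = f (i0, 0)" if "i \<in> I" for i
      using eq[OF that i0] ev_components(1)[OF fs, of i] ev_components(1)[OF fs, of i0] that i0 I(1)
      by (metis subsetD)
    then have sub: "(\<lambda>i. (i, 0)) ` I \<subseteq> {p \<in> discs k. f p = f (i0, 0)}"
      using I(1) by (auto simp: discs_def)
    have fib: "finite {p \<in> discs k. f p = f (i0, 0)}" "card {p \<in> discs k. f p = f (i0, 0)} < r"
      using f by (auto simp: r_immersions_def)
    have "card ((\<lambda>i. (i, 0::'a)) ` I) = r" using I(2) by (simp add: card_image inj_on_def)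
    then show False using card_mono[OF fib(1) sub] fib(2) by simp
  qed
  moreover have "inj (blinfun_apply (snd (ev k f) i))" if "i \<in> {1..k}" for i
  proof -
    have "(i, 0) \<in> discs k" using that by (simp add: discs_def)
    then have "inj (frechet_derivative (\<lambda>y. f (i, y)) (at 0))"
      using f unfolding r_immersions_def by blast
    then show ?thesis by (simp add: ev_components(2)[OF fs that])
  qed
  moreover have "fst (ev k f) \<in> extensional {1..k}" "snd (ev k f) \<in> extensional {1..k}"
    by (simp_all add: ev_def)
  ultimately show ?thesis unfolding in_target_iff by blast
qed

lemma continuous_map_blinfun:
  fixes A :: "'z \<Rightarrow> 'a::fin_dim_inner \<Rightarrow>\<^sub>L 'b::real_normed_vector"
  assumes "\<And>v. continuous_map Z euclidean (\<lambda>z. A z v)"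
  shows "continuous_map Z euclidean A"
proof (rule continuous_map_euclideanI)
  fix z0 and e :: real assume z0: "z0 \<in> topspace Z" and e: "e > 0"
  have "continuous_map Z euclideanreal (\<lambda>z. \<Sum>b\<in>onb. norm (A z b - A z0 b))"
    using assms by (intro continuous_intros finite_onb) auto
  then have "openin Z {z \<in> topspace Z. (\<Sum>b\<in>onb. norm (A z b - A z0 b)) \<in> {..<e}}"
    by (rule openin_continuous_map_preimage) simp
  moreover have "norm (A z - A z0) \<le> (\<Sum>b\<in>onb. norm (A z b - A z0 b))" for z
  proof (rule norm_blinfun_bound)
    show "norm (blinfun_apply (A z - A z0) v) \<le> (\<Sum>b\<in>onb. norm (A z b - A z0 b)) * norm v" for v
      using norm_linear_le_onb[of "blinfun_apply (A z - A z0)" v]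
      by (simp add: blinfun.diff_left mult.commute bounded_linear.linear blinfun.bounded_linear_right)
  qed (simp add: sum_nonneg)
  ultimately show "\<exists>U. openin Z U \<and> z0 \<in> U \<and> (\<forall>y\<in>U. norm (A y - A z0) < e)"
    using z0 e by (intro exI[of _ "{z \<in> topspace Z. (\<Sum>b\<in>onb. norm (A z b - A z0 b)) \<in> {..<e}}"])
      (auto intro: le_less_trans)
qed

lemma topspace_rImm: "topspace (rImm r k) = r_immersions r k"
  by (auto simp: rImm_def topspace_smooth_topology r_immersions_def)

lemma continuous_map_rImm_iff:
  fixes F :: "'z \<Rightarrow> nat \<times> 'a::fin_dim_inner \<Rightarrow> 'b::real_normed_vector"
  shows "continuous_map Z (rImm r k) F \<longleftrightarrow>
    jointly_smooth Z k F \<and> (\<forall>z\<in>topspace Z. F z \<in> r_immersions r k)"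
  unfolding rImm_def continuous_map_in_subtopology jointly_smooth_iff_continuous by auto

lemma continuous_map_ev:
  assumes "0 < r"
  shows "continuous_map (rImm r k) (target r k)
    (ev k :: (nat \<times> 'a::fin_dim_inner \<Rightarrow> 'b::real_normed_vector) \<Rightarrow> _)"
proof (rule continuous_map_targetI)
  let ?X = "rImm r k :: (nat \<times> 'a \<Rightarrow> 'b) topology"
  have js: "jointly_smooth ?X k (\<lambda>f. f)"
    using continuous_map_rImm_iff[of ?X r k "\<lambda>f. f"] continuous_map_id[of ?X] by (simp add: id_def)
  have fs: "f \<in> smooth_maps k" if "f \<in> topspace ?X" for f
    using that by (simp add: topspace_rImm r_immersions_def)
  have cont: "continuous_map ?X euclidean (\<lambda>f. iter_deriv vs (\<lambda>y. f (i, y)) 0)" if i: "i \<in> {1..k}" for i vs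
  proof -
    let ?P = "prod_topology ?X (top_of_set (ball (0::'a) 1))"
    have "continuous_map ?X ?P (\<lambda>z. (z, 0))"
      by (intro continuous_map_pairedI) auto
    moreover have "continuous_map ?P euclidean (\<lambda>(f, x). iter_deriv vs (\<lambda>y. f (i, y)) x)"
      using js i unfolding jointly_smooth_def by blast
    ultimately have "continuous_map ?X euclidean ((\<lambda>(f, x). iter_deriv vs (\<lambda>y. f (i, y)) x) \<circ> (\<lambda>z. (z, 0)))"
      by (rule continuous_map_compose)
    then show ?thesis by (simp add: o_def)
  qed
  show "continuous_map ?X euclidean (\<lambda>f. fst (ev k f) i)" if "i \<in> {1..k}" for i
    using cont[OF that, of "[]"] that by (simp add: ev_def)
  show "continuous_map ?X euclidean (\<lambda>f. snd (ev k f) i)" if i: "i \<in> {1..k}" for i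
  proof (rule continuous_map_blinfun)
    show "continuous_map ?X euclidean (\<lambda>f. blinfun_apply (snd (ev k f) i) v)" for v
      using continuous_map_eq[OF cont[OF i, of "[v]"]] ev_components(2)[OF fs i] by simp
  qed
  show "ev k f \<in> topspace (target r k)" if "f \<in> topspace ?X" for f
    using that assms unfolding topspace_rImm by (rule ev_in_target)
qed

section \<open>Lifting along a collar\<close>

text \<open>
  Over a compact parameter space finitely many of the local bounds suffice. This avoids choosing
  the size of the discs as a continuous function of the map.
\<close>

lemma zoom_r_immersion_uniformly:
  fixes F :: "'z \<Rightarrow> nat \<times> 'a::fin_dim_inner \<Rightarrow> 'b::real_normed_vector"
  assumes Z: "compact_space Z" and F: "jointly_smooth Z k F"
    and ev: "\<And>z. z \<in> topspace Z \<Longrightarrow> ev k (F z) \<in> topspace (target r k)"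
  shows "\<exists>\<tau>. 0 < \<tau> \<and> \<tau> \<le> 1 \<and> (\<forall>z\<in>topspace Z. \<forall>\<tau>' s.
    0 < \<tau>' \<longrightarrow> \<tau>' \<le> \<tau> \<longrightarrow> 0 \<le> s \<longrightarrow> s \<le> 1 \<longrightarrow> zoom k \<tau>' s (F z) \<in> r_immersions r k)"
proof -
  define Q where "Q U \<tau> \<longleftrightarrow> 0 < \<tau> \<and> \<tau> \<le> (1::real) \<and>
    (\<forall>z\<in>U. \<forall>\<tau>' s. 0 < \<tau>' \<longrightarrow> \<tau>' \<le> \<tau> \<longrightarrow> 0 \<le> s \<longrightarrow> s \<le> 1 \<longrightarrow> zoom k \<tau>' s (F z) \<in> r_immersions r k)" for U \<tau>
  have "\<exists>U \<tau>. openin Z U \<and> z \<in> U \<and> Q U \<tau>" if z: "z \<in> topspace Z" for z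
    unfolding Q_def
  proof (rule zoom_r_immersion_locally[OF F z])
    have Fz: "F z \<in> smooth_maps k" using F z by (simp add: jointly_smooth_def)
    have t: "no_r_equal r k (fst (ev k (F z)))" "\<forall>i\<in>{1..k}. inj (blinfun_apply (snd (ev k (F z)) i))"
      using ev[OF z] unfolding in_target_iff by blast+
    show "no_r_equal r k (\<lambda>i. F z (i, 0))"
      unfolding no_r_equal_def
    proof
      assume "\<exists>I\<subseteq>{1..k}. card I = r \<and> (\<forall>i\<in>I. \<forall>j\<in>I. F z (i, 0) = F z (j, 0))"
      then obtain I where I: "I \<subseteq> {1..k}" "card I = r"
        "\<And>i j. i \<in> I \<Longrightarrow> j \<in> I \<Longrightarrow> F z (i, 0) = F z (j, 0)" by blast
      have "fst (ev k (F z)) i = fst (ev k (F z)) j" if "i \<in> I" "j \<in> I" for i j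
        using ev_components(1)[OF Fz subsetD[OF I(1) that(1)]]
          ev_components(1)[OF Fz subsetD[OF I(1) that(2)]] I(3)[OF that] by simp
      with I(1,2) t(1) show False unfolding no_r_equal_def by blast
    qed
    show "inj (frechet_derivative (\<lambda>y. F z (i, y)) (at 0))" if "i \<in> {1..k}" for i
      using bspec[OF t(2) that] by (simp add: ev_components(2)[OF Fz that])
  qed
  then obtain U \<tau> where U: "\<And>z. z \<in> topspace Z \<Longrightarrow> openin Z (U z)" "\<And>z. z \<in> topspace Z \<Longrightarrow> z \<in> U z"
    and Q: "\<And>z. z \<in> topspace Z \<Longrightarrow> Q (U z) (\<tau> z)"
    by metis
  have "\<exists>\<F>. finite \<F> \<and> \<F> \<subseteq> U ` topspace Z \<and> topspace Z \<subseteq> \<Union>\<F>"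
    using Z U unfolding compact_space_alt by (elim allE[of _ "U ` topspace Z"]) blast
  then obtain S where S: "finite S" "S \<subseteq> topspace Z" "topspace Z \<subseteq> (\<Union>z\<in>S. U z)"
    by (metis finite_subset_image)
  obtain d where d: "0 < d" "\<And>z. z \<in> S \<Longrightarrow> d \<le> \<tau> z"
    using finite_positive_lower_bound[OF S(1), of \<tau>] Q S(2) unfolding Q_def by blast
  show ?thesis
  proof (intro exI[of _ "min d 1"] conjI ballI allI impI)
    fix z \<tau>' s assume z: "z \<in> topspace Z" and h: "0 < \<tau>'" "\<tau>' \<le> min d 1" "0 \<le> s" "s \<le> (1::real)"
    obtain w where w: "w \<in> S" "z \<in> U w" using S(3) z by blast
    have "\<tau>' \<le> \<tau> w" using d(2)[OF w(1)] h(2) by simp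
    then show "zoom k \<tau>' s (F z) \<in> r_immersions r k"
      using Q[of w] w S(2) h unfolding Q_def by blast
  qed (use d in auto)
qed

text \<open>
  The lifting property from which all of weak equivalence follows. The function \<open>W\<close> measures the
  depth inside \<open>Z\<close>, and \<open>\<rho>\<close> collapses the collar \<open>W \<le> 1\<close> into \<open>B\<close>. Beyond the collar the family \<open>b\<close>
  is lifted by small affine maps. Inside the collar the given lift \<open>a0\<close> is deformed to these: for
  \<open>W\<close> up to \<open>1/2\<close> the discs are shrunk to a common size \<open>\<tau>\<close>, and from then on they are magnified until
  the maps are affine. The two prescriptions agree at \<open>W = 1\<close> because the affine map depends only on
  the image under evaluation. The factor \<open>\<nu>\<close> records the accumulated shrinking.
\<close>

proposition lift_along_collar:
  fixes a0 :: "'z \<Rightarrow> nat \<times> 'a::fin_dim_inner \<Rightarrow> 'b::real_normed_vector"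
  assumes r: "0 < r" and Z: "compact_space Z" and B: "closedin Z B"
    and b: "continuous_map Z (target r k) b"
    and a0: "continuous_map (subtopology Z B) (rImm r k) a0"
    and ev_a0: "\<And>t. t \<in> B \<Longrightarrow> ev k (a0 t) = b t"
    and \<rho>: "continuous_map Z Z \<rho>"
    and W: "continuous_map Z euclideanreal W" "\<And>t. t \<in> topspace Z \<Longrightarrow> 0 \<le> W t"
      "\<And>t. t \<in> topspace Z \<Longrightarrow> W t \<le> 1 \<Longrightarrow> \<rho> t \<in> B"
  obtains a \<nu> where "continuous_map Z (rImm r k) a" "continuous_map Z euclideanreal \<nu>"
    "\<And>t. t \<in> topspace Z \<Longrightarrow> 0 < \<nu> t"
    "\<And>t. t \<in> topspace Z \<Longrightarrow> W t = 0 \<Longrightarrow> a t = a0 (\<rho> t) \<and> \<nu> t = 1"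
    "\<And>t. t \<in> topspace Z \<Longrightarrow> ev k (a t) = scale_target k (\<nu> t) (b (\<rho> t))"
proof -
  have BZ: "B \<subseteq> topspace Z" using B by (rule closedin_subset)
  have js_a0: "jointly_smooth (subtopology Z B) k a0"
    and a0_imm: "\<And>t. t \<in> B \<Longrightarrow> a0 t \<in> r_immersions r k"
    using a0 BZ unfolding continuous_map_rImm_iff by auto
  have a0_smooth: "a0 t \<in> smooth_maps k" if "t \<in> B" for t
    using a0_imm[OF that] by (simp add: r_immersions_def)
  have comp: "compact_space (subtopology Z B)"
    using Z B by (simp add: closedin_compact_space compact_space_subtopology)
  have ev1: "ev k (a0 t) \<in> topspace (target r k)" if "t \<in> topspace (subtopology Z B)" for t
    using a0_imm[of t] that r by (intro ev_in_target) auto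
  obtain \<tau>1 where \<tau>1: "0 < \<tau>1" "\<tau>1 \<le> 1"
    "\<And>t \<tau>' s. t \<in> topspace (subtopology Z B) \<Longrightarrow> 0 < \<tau>' \<Longrightarrow> \<tau>' \<le> \<tau>1 \<Longrightarrow> 0 \<le> s \<Longrightarrow> s \<le> 1 \<Longrightarrow>
      zoom k \<tau>' s (a0 t) \<in> r_immersions r k"
    using zoom_r_immersion_uniformly[OF comp js_a0 ev1] by blast
  have bt: "b t \<in> topspace (target r k)" if "t \<in> topspace Z" for t
    using continuous_map_targetD(3)[OF b that] .
  have ev2: "ev k (affine_map k (b t)) \<in> topspace (target r k)" if "t \<in> topspace Z" for t
    using bt[OF that] by (simp only: ev_affine_map[OF bt[OF that]])
  obtain \<tau>2 where \<tau>2: "0 < \<tau>2" "\<tau>2 \<le> 1"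
    "\<And>t \<tau>' s. t \<in> topspace Z \<Longrightarrow> 0 < \<tau>' \<Longrightarrow> \<tau>' \<le> \<tau>2 \<Longrightarrow> 0 \<le> s \<Longrightarrow> s \<le> 1 \<Longrightarrow>
      zoom k \<tau>' s (affine_map k (b t)) \<in> r_immersions r k"
    using zoom_r_immersion_uniformly[OF Z jointly_smooth_affine_map[OF b] ev2] by blast
  define \<tau> where "\<tau> = min \<tau>1 \<tau>2"
  have \<tau>: "0 < \<tau>" "\<tau> \<le> 1" "\<tau> \<le> \<tau>1" "\<tau> \<le> \<tau>2" using \<tau>1 \<tau>2 by (auto simp: \<tau>_def)
  have affine_imm: "affine_map k (scale_target k \<tau> (b t)) \<in> r_immersions r k" if "t \<in> topspace Z" for t
    using \<tau>2(3)[OF that \<tau>(1,4), of 0]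
    by (simp add: zoom_0_eq_affine_map[OF affine_map_smooth_maps] ev_affine_map[OF bt[OF that]])
  \<comment> \<open>Magnification, \<open>s u < 1\<close>, sets in at \<open>u = 1/2\<close>, when \<open>\<sigma> u\<close> has already reached \<open>\<tau>\<close>; so at each
    depth one of the two parameters is at the value for which r-immersions are guaranteed.\<close>
  define \<sigma> where "\<sigma> u = max \<tau> (1 - 2 * u)" for u
  define s where "s u = min 1 (2 - 2 * u)" for u :: real
  define a where "a t = (if W t \<le> 1 then zoom k (\<sigma> (W t)) (s (W t)) (a0 (\<rho> t))
    else affine_map k (scale_target k \<tau> (b (\<rho> t))))" for t
  have \<sigma>: "0 < \<sigma> u" "\<sigma> u \<le> 1" if "0 \<le> u" for u using that \<tau> by (auto simp: \<sigma>_def)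
  have s: "0 \<le> s u" "s u \<le> 1" if "u \<le> 1" for u using that by (auto simp: s_def)
  have \<rho>t: "\<rho> t \<in> topspace Z" if "t \<in> topspace Z" for t
    using continuous_map_image_subset_topspace[OF \<rho>] that by blast
  have outer_imm: "zoom k (\<sigma> (W t)) (s (W t)) (a0 (\<rho> t)) \<in> r_immersions r k"
    if t: "t \<in> topspace Z" "W t \<le> 1" for t
  proof -
    have \<rho>B: "\<rho> t \<in> B" by (rule W(3)[OF t])
    show ?thesis
    proof (cases "W t \<le> 1/2")
      case True
      then have "s (W t) = 1" by (simp add: s_def)
      then show ?thesis
        using zoom_1_r_immersion[OF a0_imm[OF \<rho>B]] \<sigma>[OF W(2)[OF t(1)]] by simp
    next
      case False
      then have "\<sigma> (W t) = \<tau>" using \<tau> by (simp add: \<sigma>_def)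
      then show ?thesis
        using \<tau>1(3)[of "\<rho> t" \<tau> "s (W t)"] \<tau> s[OF t(2)] \<rho>B BZ by auto
    qed
  qed
  have "continuous_map Z (rImm r k) a"
    unfolding a_def
  proof (rule continuous_map_cases_le)
    let ?R = "subtopology Z {t \<in> topspace Z. W t \<le> 1}"
    show "continuous_map ?R (rImm r k) (\<lambda>t. zoom k (\<sigma> (W t)) (s (W t)) (a0 (\<rho> t)))"
      unfolding continuous_map_rImm_iff
    proof (intro conjI ballI jointly_smooth_zoom)
      have "continuous_map ?R (subtopology Z B) \<rho>"
        using W(3) by (auto simp: continuous_map_in_subtopology intro: continuous_map_from_subtopology[OF \<rho>])
      from continuous_map_compose[OF this a0]
      show "jointly_smooth ?R k (\<lambda>t. a0 (\<rho> t))"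
        unfolding continuous_map_rImm_iff o_def by blast
      have W': "continuous_map ?R euclideanreal W" by (rule continuous_map_from_subtopology[OF W(1)])
      show "continuous_map ?R euclideanreal (\<lambda>t. \<sigma> (W t))" "continuous_map ?R euclideanreal (\<lambda>t. s (W t))"
        unfolding \<sigma>_def s_def by (intro continuous_intros W')+
    qed (use \<sigma> s W(2) outer_imm in auto)
    show "continuous_map (subtopology Z {t \<in> topspace Z. 1 \<le> W t}) (rImm r k)
      (\<lambda>t. affine_map k (scale_target k \<tau> (b (\<rho> t))))"
    proof (rule continuous_map_from_subtopology)
      have "continuous_map Z (target r k) (\<lambda>t. scale_target k \<tau> (b (\<rho> t)))"
        using continuous_map_scale_target[OF _ _ continuous_map_compose[OF \<rho> b], of "\<lambda>_. \<tau>"] \<tau>(1)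
        by (simp add: o_def)
      then show "continuous_map Z (rImm r k) (\<lambda>t. affine_map k (scale_target k \<tau> (b (\<rho> t))))"
        unfolding continuous_map_rImm_iff using jointly_smooth_affine_map affine_imm \<rho>t by blast
    qed
    show "zoom k (\<sigma> (W t)) (s (W t)) (a0 (\<rho> t)) = affine_map k (scale_target k \<tau> (b (\<rho> t)))"
      if t: "t \<in> topspace Z" "W t = 1" for t
    proof -
      have "\<rho> t \<in> B" using W(3) t by simp
      moreover have "\<sigma> (W t) = \<tau>" "s (W t) = 0" using \<tau> t by (auto simp: \<sigma>_def s_def)
      ultimately show ?thesis using a0_smooth ev_a0 by (simp add: zoom_0_eq_affine_map)
    qed
  qed (use W(1) in auto)
  moreover have "continuous_map Z euclideanreal (\<lambda>t. \<sigma> (W t))"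
    unfolding \<sigma>_def by (intro continuous_intros W(1))
  moreover have "0 < \<sigma> (W t)" if "t \<in> topspace Z" for t using \<sigma>(1)[OF W(2)[OF that]] .
  moreover have "a t = a0 (\<rho> t) \<and> \<sigma> (W t) = 1" if t: "t \<in> topspace Z" "W t = 0" for t
  proof -
    have "\<rho> t \<in> B" using W(3)[OF t(1)] t(2) by simp
    then show ?thesis using t \<tau> by (simp add: a_def \<sigma>_def s_def zoom_1_1[OF a0_smooth])
  qed
  moreover have "ev k (a t) = scale_target k (\<sigma> (W t)) (b (\<rho> t))" if t: "t \<in> topspace Z" for t
  proof (cases "W t \<le> 1")
    case True
    have "\<rho> t \<in> B" by (rule W(3)[OF t True])
    then show ?thesis
      using ev_zoom[OF a0_smooth \<sigma>(1) \<sigma>(2) s(1) s(2)] W(2)[OF t] True ev_a0 by (simp add: a_def)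
  next
    case False
    then have "\<sigma> (W t) = \<tau>" using \<tau> by (simp add: \<sigma>_def)
    moreover have "scale_target k \<tau> (b (\<rho> t)) \<in> topspace (target r k)"
      using \<tau>(1) by (intro scale_target_in_target bt \<rho>t t) simp
    ultimately show ?thesis using False by (simp only: a_def ev_affine_map if_False)
  qed
  ultimately show ?thesis by (rule that)
qed

section \<open>Collars of cubes\<close>

text \<open>
  A piecewise linear map of the unit interval onto itself that collapses the outer quarters to the
  end points, and a depth function that is at most 1 exactly there. Applied coordinatewise they
  provide the collar of a cube. Points of the boundary move within their face, which is enough for maps that are constant
  on the boundary.
\<close>

definition squash :: "real \<Rightarrow> real" where "squash u = max 0 (min 1 (2 * u - 1/2))"
definition depth :: "real \<Rightarrow> real" where "depth u = 4 * min u (1 - u)"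

lemma squash_in_unit: "squash u \<in> {0..1}"
  and squash_0: "squash 0 = 0" and squash_1: "squash 1 = 1"
  by (auto simp: squash_def)

lemma depth_nonneg: "u \<in> {0..1} \<Longrightarrow> 0 \<le> depth u"
  and depth_eq_0: "depth 0 = 0" "depth 1 = 0"
  and depth_le_0: "u \<in> {0..1} \<Longrightarrow> depth u \<le> 0 \<Longrightarrow> u = 0 \<or> u = 1"
  and depth_le_1: "depth u \<le> 1 \<Longrightarrow> squash u = 0 \<or> squash u = 1"
  by (auto simp: depth_def squash_def min_def split: if_splits)

text \<open>
  The minimum of the depths of the coordinates. The value 2 for the cube of dimension 0, whose
  boundary is empty, places its only point beyond the collar.
\<close>

primrec cube_depth :: "nat \<Rightarrow> (nat \<Rightarrow> real) \<Rightarrow> real" where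
  "cube_depth 0 t = 2"
| "cube_depth (Suc q) t = min (cube_depth q t) (depth (t q))"

definition cube_squash :: "nat \<Rightarrow> (nat \<Rightarrow> real) \<Rightarrow> nat \<Rightarrow> real"
  where "cube_squash q t = (\<lambda>j\<in>{..<q}. squash (t j))"

text \<open>
  The linear homotopy from \<^const>\<open>cube_squash\<close> to the identity.
\<close>

definition cube_mix :: "nat \<Rightarrow> real \<Rightarrow> (nat \<Rightarrow> real) \<Rightarrow> nat \<Rightarrow> real"
  where "cube_mix q u t = (\<lambda>j\<in>{..<q}. (1 - u) * squash (t j) + u * t j)"

lemma topspace_cube: "topspace (cube q) = {..<q} \<rightarrow>\<^sub>E {0..1}"
  by (simp add: cube_def)

lemma cube_depth_le_iff: "cube_depth q t \<le> c \<longleftrightarrow> 2 \<le> c \<or> (\<exists>j<q. depth (t j) \<le> c)"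
  by (induction q) (auto simp: min_le_iff_disj less_Suc_eq)

lemma cube_depth_nonneg: "t \<in> topspace (cube q) \<Longrightarrow> 0 \<le> cube_depth q t"
proof (induction q arbitrary: t)
  case (Suc q)
  have "t q \<in> {0..1}" using Suc.prems by (auto simp: topspace_cube PiE_iff)
  moreover have "restrict t {..<q} \<in> topspace (cube q)"
    using Suc.prems by (auto simp: topspace_cube PiE_iff)
  moreover have "cube_depth q (restrict t {..<q}) = cube_depth q t"
  proof -
    have "cube_depth p (restrict t {..<q}) = cube_depth p t" if "p \<le> q" for p
      using that by (induction p) auto
    then show ?thesis by simp
  qed
  ultimately show ?case using Suc.IH depth_nonneg by fastforce
qed simp

lemma cube_boundary_iff_depth:
  assumes t: "t \<in> topspace (cube q)"
  shows "t \<in> cube_boundary q \<longleftrightarrow> cube_depth q t \<le> 0"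
proof -
  have "t j \<in> {0..1}" if "j < q" for j using t that by (auto simp: topspace_cube PiE_iff)
  then have "(t j = 0 \<or> t j = 1) \<longleftrightarrow> depth (t j) \<le> 0" if "j < q" for j
    using that depth_le_0 depth_eq_0 by fastforce
  then show ?thesis using t by (auto simp: cube_boundary_def cube_depth_le_iff)
qed

lemma cube_boundary_depth_0:
  "t \<in> cube_boundary q \<Longrightarrow> cube_depth q t = 0"
  using cube_boundary_iff_depth cube_depth_nonneg by (fastforce simp: cube_boundary_def)

lemma cube_squash_in_boundary: "cube_depth q t \<le> 1 \<Longrightarrow> cube_squash q t \<in> cube_boundary q"
  using depth_le_1 squash_in_unit
  by (fastforce simp: cube_depth_le_iff cube_boundary_def topspace_cube cube_squash_def)

lemma continuous_map_cube_coordinate: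
  "j < q \<Longrightarrow> continuous_map (cube q) euclideanreal (\<lambda>t. t j)"
  unfolding cube_def
  by (rule continuous_map_into_fulltopology[of _ _ "{0..1}"])
    (use continuous_map_product_projection[of j "{..<q}" "\<lambda>_. top_of_set {0..1}"] in simp)

lemma continuous_map_cube_depth: "continuous_map (cube q) euclideanreal (cube_depth q)"
proof -
  have "continuous_map (cube q) euclideanreal (cube_depth p)" if "p \<le> q" for p
    using that
  proof (induction p)
    case (Suc p)
    then show ?case
      by (simp add: depth_def) (intro continuous_intros continuous_map_cube_coordinate; simp)
  next
    case 0
    have "cube_depth 0 = (\<lambda>_. 2)" by (rule ext) simp
    then show ?case by simp
  qed
  then show ?thesis by simp
qed

lemma closedin_cube_boundary: "closedin (cube q) (cube_boundary q)"
proof -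
  have "closedin (cube q) {t \<in> topspace (cube q). cube_depth q t \<in> {..0}}"
    by (rule closedin_continuous_map_preimage[OF continuous_map_cube_depth]) simp
  moreover have "{t \<in> topspace (cube q). cube_depth q t \<in> {..0}} = cube_boundary q"
    using cube_boundary_iff_depth by (auto simp: cube_boundary_def)
  ultimately show ?thesis by simp
qed

lemma compact_space_cube: "compact_space (cube q)"
  unfolding cube_def by (simp add: compact_space_product_topology compact_space_subtopology)

lemma mix_in_unit:
  assumes "u \<in> {0..1::real}" "a \<in> {0..1}" "b \<in> {0..1}"
  shows "(1 - u) * a + u * b \<in> {0..1}"
  using assms convex_bound_le[of a 1 b "1 - u" u] by simp

lemma continuous_map_cube_mix:
  "continuous_map (prod_topology (top_of_set {0..1}) (cube q)) (cube q) (\<lambda>(u, t). cube_mix q u t)"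
proof -
  let ?Z = "prod_topology (top_of_set {0..1::real}) (cube q)"
  have "continuous_map ?Z (top_of_set {0..1}) (\<lambda>p. cube_mix q (fst p) (snd p) j)" if j: "j < q" for j
  proof (rule continuous_map_into_subtopology)
    have u: "continuous_map ?Z euclideanreal (\<lambda>p. fst p)"
      using continuous_map_into_fulltopology[OF continuous_map_fst] by auto
    have t: "continuous_map ?Z euclideanreal (\<lambda>p. snd p j)"
      using continuous_map_compose[OF continuous_map_snd continuous_map_cube_coordinate[OF j]]
      by (simp add: o_def)
    show "continuous_map ?Z euclideanreal (\<lambda>p. cube_mix q (fst p) (snd p) j)"
      using j by (simp add: cube_mix_def squash_def) (intro continuous_intros u t)
    show "(\<lambda>p. cube_mix q (fst p) (snd p) j) \<in> topspace ?Z \<rightarrow> {0..1}"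
    proof
      fix p assume "p \<in> topspace ?Z"
      then have "fst p \<in> {0..1}" and t: "snd p \<in> {..<q} \<rightarrow>\<^sub>E {0..1}"
        by (simp_all add: mem_Times_iff topspace_cube)
      moreover have "snd p j \<in> {0..1}" using PiE_mem[OF t] j by simp
      ultimately show "cube_mix q (fst p) (snd p) j \<in> {0..1}"
        using mix_in_unit[OF _ squash_in_unit] j by (simp add: cube_mix_def)
    qed
  qed
  then show ?thesis
    unfolding cube_def[of q] case_prod_unfold
    by (intro continuous_map_coordinatewise_then_product) (auto simp: cube_def cube_mix_def)
qed

lemma cube_mix_0: "cube_mix q 0 t = cube_squash q t"
  by (simp add: cube_mix_def cube_squash_def)

lemma cube_mix_1: "t \<in> topspace (cube q) \<Longrightarrow> cube_mix q 1 t = t"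
  by (auto simp: cube_mix_def topspace_cube PiE_iff extensional_def)

lemma continuous_map_cube_squash: "continuous_map (cube q) (cube q) (cube_squash q)"
proof -
  have "continuous_map (cube q) (prod_topology (top_of_set {0..1}) (cube q)) (\<lambda>t. (0::real, t))"
    using continuous_map_id[of "cube q"] by (intro continuous_map_pairedI) (auto simp: id_def)
  from continuous_map_compose[OF this continuous_map_cube_mix]
  show ?thesis by (simp add: o_def cube_mix_0)
qed

lemma cube_mix_boundary:
  assumes u: "u \<in> {0..1}" and t: "t \<in> cube_boundary q"
  shows "cube_mix q u t \<in> cube_boundary q"
proof -
  obtain j where j: "j < q" "t j = 0 \<or> t j = 1" and tq: "t \<in> topspace (cube q)"
    using t by (auto simp: cube_boundary_def)
  have "cube_mix q u t \<in> topspace (cube q)"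
    using continuous_map_image_subset_topspace[OF continuous_map_cube_mix[of q]] u tq by force
  moreover have "cube_mix q u t j = t j"
    using j by (auto simp: cube_mix_def squash_0 squash_1)
  ultimately show ?thesis using j by (auto simp: cube_boundary_def)
qed

section \<open>Bijectivity on homotopy groups and path components\<close>

lemma spheroid_homotopy_iff:
  "(a, b) \<in> spheroid_homotopy q X x \<longleftrightarrow>
    (\<exists>h. continuous_map (prod_topology (top_of_set {0..1::real}) (cube q)) X h \<and>
      (\<forall>t\<in>topspace (cube q). h (0, t) = a t) \<and> (\<forall>t\<in>topspace (cube q). h (1, t) = b t) \<and>
      (\<forall>u\<in>{0..1::real}. \<forall>t\<in>cube_boundary q. h (u, t) = x))"
proof -
  let ?P = "\<lambda>h. h ` cube_boundary q \<subseteq> {x}"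
  have "?P h \<longleftrightarrow> ?P k" if "\<And>t. t \<in> topspace (cube q) \<Longrightarrow> h t = k t" for h k
  proof -
    have "h ` cube_boundary q = k ` cube_boundary q"
      using that by (intro image_cong) (auto simp: cube_boundary_def)
    then show ?thesis by simp
  qed
  from homotopic_with[where P = ?P and X = "cube q" and Y = X and p = a and q = b, OF this]
  show ?thesis
    by (simp add: spheroid_homotopy_def image_subset_iff)
qed

lemma spheroid_homotopy_sym: "(a, b) \<in> spheroid_homotopy q X x \<Longrightarrow> (b, a) \<in> spheroid_homotopy q X x"
  unfolding spheroid_homotopy_def by (simp add: homotopic_with_symD)

lemma spheroid_homotopy_trans:
  "(a, b) \<in> spheroid_homotopy q X x \<Longrightarrow> (b, c) \<in> spheroid_homotopy q X x \<Longrightarrow>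
    (a, c) \<in> spheroid_homotopy q X x"
  unfolding spheroid_homotopy_def by (auto intro: homotopic_with_trans)

lemma spheroid_homotopy_compose:
  assumes "(a, b) \<in> spheroid_homotopy q X x" "continuous_map X Y \<phi>"
  shows "(\<phi> \<circ> a, \<phi> \<circ> b) \<in> spheroid_homotopy q Y (\<phi> x)"
  using assms unfolding spheroid_homotopy_def
  by (auto intro!: homotopic_with_compose_continuous_map_left[where p = "\<lambda>h. h ` cube_boundary q \<subseteq> {x}"])

lemma spheroid_homotopy_refl: "a \<in> spheroids q X x \<Longrightarrow> (a, a) \<in> spheroid_homotopy q X x"
  by (simp add: spheroids_def spheroid_homotopy_def)

text \<open>
  The linear homotopy preserves the boundary of the cube, where the spheroid is constant.
\<close>

lemma spheroid_homotopy_squash: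
  assumes a: "a \<in> spheroids q X x"
  shows "(a \<circ> cube_squash q, a) \<in> spheroid_homotopy q X x"
  unfolding spheroid_homotopy_iff
proof (intro exI[of _ "a \<circ> (\<lambda>(u, t). cube_mix q u t)"] conjI ballI)
  have a': "continuous_map (cube q) X a" "\<And>t. t \<in> cube_boundary q \<Longrightarrow> a t = x"
    using a by (auto simp: spheroids_def)
  show "continuous_map (prod_topology (top_of_set {0..1}) (cube q)) X (a \<circ> (\<lambda>(u, t). cube_mix q u t))"
    by (rule continuous_map_compose[OF continuous_map_cube_mix a'(1)])
  show "(a \<circ> (\<lambda>(u, t). cube_mix q u t)) (u, t) = x" if "u \<in> {0..1}" "t \<in> cube_boundary q" for u t
    using a'(2)[OF cube_mix_boundary[OF that]] by simp
qed (simp_all add: cube_mix_0 cube_mix_1)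

lemma homotopy_group_map_class:
  assumes \<phi>: "continuous_map X Y \<phi>" and a: "a \<in> spheroids q X x"
  shows "homotopy_group_map q Y (\<phi> x) \<phi> (spheroid_homotopy q X x `` {a}) =
    spheroid_homotopy q Y (\<phi> x) `` {\<phi> \<circ> a}"
proof (intro equalityI subsetI)
  fix c assume "c \<in> homotopy_group_map q Y (\<phi> x) \<phi> (spheroid_homotopy q X x `` {a})"
  then obtain a' where a': "(a, a') \<in> spheroid_homotopy q X x" "(\<phi> \<circ> a', c) \<in> spheroid_homotopy q Y (\<phi> x)"
    unfolding homotopy_group_map_def by blast
  from spheroid_homotopy_trans[OF spheroid_homotopy_compose[OF a'(1) \<phi>] a'(2)]
  show "c \<in> spheroid_homotopy q Y (\<phi> x) `` {\<phi> \<circ> a}" by simp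
next
  fix c assume "c \<in> spheroid_homotopy q Y (\<phi> x) `` {\<phi> \<circ> a}"
  then show "c \<in> homotopy_group_map q Y (\<phi> x) \<phi> (spheroid_homotopy q X x `` {a})"
    using spheroid_homotopy_refl[OF a] unfolding homotopy_group_map_def by blast
qed

lemma spheroids_compose:
  "continuous_map X Y \<phi> \<Longrightarrow> a \<in> spheroids q X x \<Longrightarrow> \<phi> \<circ> a \<in> spheroids q Y (\<phi> x)"
  by (auto simp: spheroids_def intro: continuous_map_compose)

lemma homotopy_class_eq_iff:
  assumes "b \<in> spheroids q X x"
  shows "spheroid_homotopy q X x `` {a} = spheroid_homotopy q X x `` {b} \<longleftrightarrow>
    (a, b) \<in> spheroid_homotopy q X x"
proof
  assume "spheroid_homotopy q X x `` {a} = spheroid_homotopy q X x `` {b}"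
  then have "b \<in> spheroid_homotopy q X x `` {a}"
    using spheroid_homotopy_refl[OF assms] by simp
  then show "(a, b) \<in> spheroid_homotopy q X x" by simp
next
  assume ab: "(a, b) \<in> spheroid_homotopy q X x"
  show "spheroid_homotopy q X x `` {a} = spheroid_homotopy q X x `` {b}"
    using spheroid_homotopy_trans[OF ab] spheroid_homotopy_trans[OF spheroid_homotopy_sym[OF ab]]
    by (intro equalityI subsetI) simp_all
qed

lemma bij_betw_homotopy_group_map:
  assumes \<phi>: "continuous_map X Y \<phi>"
    and surj: "\<And>b. b \<in> spheroids q Y (\<phi> x) \<Longrightarrow>
      \<exists>a\<in>spheroids q X x. (\<phi> \<circ> a, b) \<in> spheroid_homotopy q Y (\<phi> x)"
    and inj: "\<And>a a'. a \<in> spheroids q X x \<Longrightarrow> a' \<in> spheroids q X x \<Longrightarrow>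
      (\<phi> \<circ> a, \<phi> \<circ> a') \<in> spheroid_homotopy q Y (\<phi> x) \<Longrightarrow> (a, a') \<in> spheroid_homotopy q X x"
  shows "bij_betw (homotopy_group_map q Y (\<phi> x) \<phi>) (homotopy_group q X x) (homotopy_group q Y (\<phi> x))"
  unfolding bij_betw_def
proof
  show "inj_on (homotopy_group_map q Y (\<phi> x) \<phi>) (homotopy_group q X x)"
  proof (rule inj_onI)
    fix C C' assume C: "C \<in> homotopy_group q X x" and C': "C' \<in> homotopy_group q X x"
    obtain a where a: "a \<in> spheroids q X x" "C = spheroid_homotopy q X x `` {a}"
      using C unfolding homotopy_group_def by (elim quotientE)
    obtain a' where a': "a' \<in> spheroids q X x" "C' = spheroid_homotopy q X x `` {a'}"
      using C' unfolding homotopy_group_def by (elim quotientE)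
    assume "homotopy_group_map q Y (\<phi> x) \<phi> C = homotopy_group_map q Y (\<phi> x) \<phi> C'"
    then have "(\<phi> \<circ> a, \<phi> \<circ> a') \<in> spheroid_homotopy q Y (\<phi> x)"
      unfolding a(2) a'(2) homotopy_group_map_class[OF \<phi> a(1)] homotopy_group_map_class[OF \<phi> a'(1)]
        homotopy_class_eq_iff[OF spheroids_compose[OF \<phi> a'(1)]] .
    from inj[OF a(1) a'(1) this] show "C = C'"
      unfolding a(2) a'(2) homotopy_class_eq_iff[OF a'(1)] .
  qed
  show "homotopy_group_map q Y (\<phi> x) \<phi> ` homotopy_group q X x = homotopy_group q Y (\<phi> x)"
  proof (intro equalityI subsetI)
    fix D assume "D \<in> homotopy_group_map q Y (\<phi> x) \<phi> ` homotopy_group q X x"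
    then obtain a where a: "a \<in> spheroids q X x"
      and D: "D = homotopy_group_map q Y (\<phi> x) \<phi> (spheroid_homotopy q X x `` {a})"
      unfolding homotopy_group_def by (elim imageE quotientE) blast
    show "D \<in> homotopy_group q Y (\<phi> x)"
      unfolding D homotopy_group_map_class[OF \<phi> a] homotopy_group_def
      by (rule quotientI[OF spheroids_compose[OF \<phi> a]])
  next
    fix D assume "D \<in> homotopy_group q Y (\<phi> x)"
    then obtain b where b: "b \<in> spheroids q Y (\<phi> x)" "D = spheroid_homotopy q Y (\<phi> x) `` {b}"
      unfolding homotopy_group_def by (elim quotientE)
    obtain a where a: "a \<in> spheroids q X x" "(\<phi> \<circ> a, b) \<in> spheroid_homotopy q Y (\<phi> x)"
      using surj[OF b(1)] by blast
    have "D = homotopy_group_map q Y (\<phi> x) \<phi> (spheroid_homotopy q X x `` {a})"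
      using a(2) unfolding b(2) homotopy_group_map_class[OF \<phi> a(1)] homotopy_class_eq_iff[OF b(1), symmetric]
      by simp
    moreover have "spheroid_homotopy q X x `` {a} \<in> homotopy_group q X x"
      unfolding homotopy_group_def by (rule quotientI[OF a(1)])
    ultimately show "D \<in> homotopy_group_map q Y (\<phi> x) \<phi> ` homotopy_group q X x" by blast
  qed
qed

lemma path_component_of_set_eq:
  assumes "path_component_of Y a b"
  shows "path_component_of_set Y a = path_component_of_set Y b"
  using iffD1[OF path_component_of_equiv assms] by (elim conjE) (rule arg_cong[where f = Collect])

lemma path_components_map_class:
  assumes \<phi>: "continuous_map X Y \<phi>" and x: "x \<in> topspace X"
  shows "path_components_map Y \<phi> (path_component_of_set X x) = path_component_of_set Y (\<phi> x)"
proof -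
  have "path_component_of_set Y (\<phi> x') = path_component_of_set Y (\<phi> x)" if x': "path_component_of X x x'" for x'
  proof -
    obtain g where "pathin X g" "g 0 = x" "g 1 = x'" using x' unfolding path_component_of_def by blast
    then have "path_component_of Y (\<phi> x) (\<phi> x')"
      unfolding path_component_of_def pathin_def
      using continuous_map_compose[of "top_of_set {0..1}" X g Y \<phi>] \<phi> by (intro exI[of _ "\<phi> \<circ> g"]) simp
    from path_component_of_set_eq[OF this] show ?thesis by (rule sym)
  qed
  moreover have "path_component_of X x x" using x by (simp add: path_component_of_refl)
  ultimately show ?thesis unfolding path_components_map_def by blast
qed

lemma bij_betw_path_components_map:
  assumes \<phi>: "continuous_map X Y \<phi>"
    and surj: "\<And>y. y \<in> topspace Y \<Longrightarrow> \<exists>x\<in>topspace X. path_component_of Y (\<phi> x) y"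
    and inj: "\<And>x x'. x \<in> topspace X \<Longrightarrow> x' \<in> topspace X \<Longrightarrow> path_component_of Y (\<phi> x) (\<phi> x') \<Longrightarrow>
      path_component_of X x x'"
  shows "bij_betw (path_components_map Y \<phi>) (path_components_of X) (path_components_of Y)"
  unfolding bij_betw_def
proof
  have \<phi>Y: "\<phi> x \<in> topspace Y" if "x \<in> topspace X" for x
    using continuous_map_image_subset_topspace[OF \<phi>] that by blast
  show "inj_on (path_components_map Y \<phi>) (path_components_of X)"
  proof (rule inj_onI)
    fix C C' assume C: "C \<in> path_components_of X" and C': "C' \<in> path_components_of X"
    obtain x where x: "x \<in> topspace X" "C = path_component_of_set X x"
      using C unfolding path_components_of_def by (elim imageE)
    obtain x' where x': "x' \<in> topspace X" "C' = path_component_of_set X x'"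
      using C' unfolding path_components_of_def by (elim imageE)
    assume "path_components_map Y \<phi> C = path_components_map Y \<phi> C'"
    then have "path_component_of_set Y (\<phi> x) = path_component_of_set Y (\<phi> x')"
      unfolding x(2) x'(2) path_components_map_class[OF \<phi> x(1)] path_components_map_class[OF \<phi> x'(1)] .
    moreover have "\<phi> x' \<in> path_component_of_set Y (\<phi> x')"
      using \<phi>Y[OF x'(1)] by (simp add: path_component_of_refl)
    ultimately have "path_component_of Y (\<phi> x) (\<phi> x')" by blast
    from inj[OF x(1) x'(1) this] show "C = C'"
      unfolding x(2) x'(2) by (rule path_component_of_set_eq)
  qed
  show "path_components_map Y \<phi> ` path_components_of X = path_components_of Y"
  proof (intro equalityI subsetI)
    fix D assume "D \<in> path_components_map Y \<phi> ` path_components_of X"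
    then obtain x where "x \<in> topspace X" "D = path_component_of_set Y (\<phi> x)"
      using path_components_map_class[OF \<phi>] unfolding path_components_of_def
      by (elim imageE) simp
    then show "D \<in> path_components_of Y"
      unfolding path_components_of_def by (intro image_eqI[of _ _ "\<phi> x"] \<phi>Y)
  next
    fix D assume "D \<in> path_components_of Y"
    then obtain y where y: "y \<in> topspace Y" "D = path_component_of_set Y y"
      unfolding path_components_of_def by (elim imageE)
    obtain x where x: "x \<in> topspace X" "path_component_of Y (\<phi> x) y" using surj[OF y(1)] by blast
    have "D = path_components_map Y \<phi> (path_component_of_set X x)"
      unfolding y(2) path_components_map_class[OF \<phi> x(1)]
      using path_component_of_set_eq[OF x(2)] by (rule sym)
    then show "D \<in> path_components_map Y \<phi> ` path_components_of X"
      unfolding path_components_of_def by (rule image_eqI[OF _ imageI[OF x(1)]])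
  qed
qed

section \<open>The evaluation map is a weak homotopy equivalence\<close>

lemma mix_positive:
  assumes "u \<in> {0..1::real}" "0 < l"
  shows "0 < (1 - u) * l + u"
  using assms by (cases "u = 1") (auto intro: add_pos_nonneg)

lemma continuous_map_unit_coordinate:
  "continuous_map (prod_topology (top_of_set {0..1::real}) Z) euclideanreal (\<lambda>p. fst p)"
  using continuous_map_into_fulltopology[OF continuous_map_fst] by auto

text \<open>
  Extend the constant lift over the boundary. The image of the resulting spheroid differs from \<open>b\<close> by
  the collar collapse and by the factor \<open>\<nu>\<close>; both are removed by linear homotopies, which are
  constant on the boundary because \<open>\<nu> = 1\<close> there.
\<close>

lemma lift_spheroid:
  fixes x :: "nat \<times> 'a::fin_dim_inner \<Rightarrow> 'b::real_normed_vector"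
  assumes r: "0 < r" and x: "x \<in> topspace (rImm r k)"
    and b: "b \<in> spheroids q (target r k) (ev k x)"
  shows "\<exists>a\<in>spheroids q (rImm r k) x. (ev k \<circ> a, b) \<in> spheroid_homotopy q (target r k) (ev k x)"
proof -
  let ?Y = "target r k :: ((nat \<Rightarrow> 'b) \<times> (nat \<Rightarrow> 'a \<Rightarrow>\<^sub>L 'b)) topology"
  have b1: "continuous_map (cube q) ?Y b" and b2: "\<And>t. t \<in> cube_boundary q \<Longrightarrow> b t = ev k x"
    using b by (auto simp: spheroids_def)
  have bq: "t \<in> topspace (cube q)" if "t \<in> cube_boundary q" for t
    using that by (simp add: cube_boundary_def)
  have const: "continuous_map (subtopology (cube q) (cube_boundary q)) (rImm r k) (\<lambda>_. x)"
    using x by simp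
  obtain a \<nu> where a: "continuous_map (cube q) (rImm r k) a" and \<nu>: "continuous_map (cube q) euclideanreal \<nu>"
    "\<And>t. t \<in> topspace (cube q) \<Longrightarrow> 0 < \<nu> t"
    and bdry: "\<And>t. t \<in> topspace (cube q) \<Longrightarrow> cube_depth q t = 0 \<Longrightarrow> a t = x \<and> \<nu> t = 1"
    and ev: "\<And>t. t \<in> topspace (cube q) \<Longrightarrow> ev k (a t) = scale_target k (\<nu> t) (b (cube_squash q t))"
    using lift_along_collar[OF r compact_space_cube closedin_cube_boundary b1 const b2[symmetric]
        continuous_map_cube_squash continuous_map_cube_depth cube_depth_nonneg cube_squash_in_boundary]
    by metis
  have "a \<in> spheroids q (rImm r k) x"
    using a bdry[OF bq cube_boundary_depth_0] by (auto simp: spheroids_def)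
  moreover have "(ev k \<circ> a, b) \<in> spheroid_homotopy q ?Y (ev k x)"
    unfolding spheroid_homotopy_iff
  proof (intro exI[of _ "\<lambda>p. scale_target k ((1 - fst p) * \<nu> (snd p) + fst p) (b (cube_mix q (fst p) (snd p)))"]
        conjI ballI)
    let ?P = "prod_topology (top_of_set {0..1::real}) (cube q)"
    show "continuous_map ?P ?Y
        (\<lambda>p. scale_target k ((1 - fst p) * \<nu> (snd p) + fst p) (b (cube_mix q (fst p) (snd p))))"
    proof (rule continuous_map_scale_target)
      have "continuous_map ?P euclideanreal (\<lambda>p. \<nu> (snd p))"
        using continuous_map_compose[OF continuous_map_snd \<nu>(1)] by (simp add: o_def)
      then show "continuous_map ?P euclideanreal (\<lambda>p. (1 - fst p) * \<nu> (snd p) + fst p)"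
        by (intro continuous_intros continuous_map_unit_coordinate)
      show "(1 - fst p) * \<nu> (snd p) + fst p \<noteq> 0" if "p \<in> topspace ?P" for p
        using mix_positive[of "fst p" "\<nu> (snd p)"] \<nu>(2)[of "snd p"] that
        by (simp add: mem_Times_iff)
      show "continuous_map ?P ?Y (\<lambda>p. b (cube_mix q (fst p) (snd p)))"
        using continuous_map_compose[OF continuous_map_cube_mix b1] by (simp add: o_def case_prod_unfold)
    qed
    fix t assume t: "t \<in> topspace (cube q)"
    show "scale_target k ((1 - fst (0, t)) * \<nu> (snd (0, t)) + fst (0, t)) (b (cube_mix q (fst (0, t)) (snd (0, t))))
        = (ev k \<circ> a) t"
      using ev[OF t] by (simp add: cube_mix_0)
    show "scale_target k ((1 - fst (1, t)) * \<nu> (snd (1, t)) + fst (1, t)) (b (cube_mix q (fst (1, t)) (snd (1, t))))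
        = b t"
      using scale_target_1[OF continuous_map_targetD(3)[OF b1 t]] by (simp add: cube_mix_1[OF t])
  next
    fix u :: real and t assume u: "u \<in> {0..1}" and t: "t \<in> cube_boundary q"
    have "\<nu> t = 1" using bdry[OF bq[OF t] cube_boundary_depth_0[OF t]] by simp
    moreover have "b (cube_mix q u t) = ev k x" by (rule b2[OF cube_mix_boundary[OF u t]])
    moreover have "ev k x \<in> topspace ?Y" using x r by (simp only: topspace_rImm ev_in_target)
    ultimately show "scale_target k ((1 - fst (u, t)) * \<nu> (snd (u, t)) + fst (u, t))
        (b (cube_mix q (fst (u, t)) (snd (u, t)))) = ev k x"
      by (simp only: fst_conv snd_conv) (simp add: scale_target_1 del: topspace_prod_topology)
  qed
  ultimately show ?thesis by blast
qed

text \<open>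
  Here the lifting property is applied to the homotopy itself, over the product of the interval and
  the cube. A lift over the boundary of this product is given by the two spheroids at the ends and by
  the constant map on the sides; it extends to a homotopy between the squashed spheroids.
\<close>

lemma lift_spheroid_homotopy:
  fixes x :: "nat \<times> 'a::fin_dim_inner \<Rightarrow> 'b::real_normed_vector"
  assumes r: "0 < r"
    and a: "a \<in> spheroids q (rImm r k) x" and a': "a' \<in> spheroids q (rImm r k) x"
    and hom: "(ev k \<circ> a, ev k \<circ> a') \<in> spheroid_homotopy q (target r k) (ev k x)"
  shows "(a, a') \<in> spheroid_homotopy q (rImm r k) x"
proof -
  let ?X = "rImm r k :: (nat \<times> 'a \<Rightarrow> 'b) topology"
  let ?Z = "prod_topology (top_of_set {0..1::real}) (cube q)"
  obtain h where h: "continuous_map ?Z (target r k) h"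
    "\<And>t. t \<in> topspace (cube q) \<Longrightarrow> h (0, t) = ev k (a t)"
    "\<And>t. t \<in> topspace (cube q) \<Longrightarrow> h (1, t) = ev k (a' t)"
    "\<And>u t. u \<in> {0..1} \<Longrightarrow> t \<in> cube_boundary q \<Longrightarrow> h (u, t) = ev k x"
    using hom unfolding spheroid_homotopy_iff by auto
  have a1: "continuous_map (cube q) ?X a" "\<And>t. t \<in> cube_boundary q \<Longrightarrow> a t = x"
    and a2: "continuous_map (cube q) ?X a'" "\<And>t. t \<in> cube_boundary q \<Longrightarrow> a' t = x"
    using a a' by (auto simp: spheroids_def)
  define W where "W p = min (depth (fst p)) (cube_depth q (snd p))" for p
  define \<rho> where "\<rho> p = (squash (fst p), cube_squash q (snd p))" for p
  define B where "B = {p \<in> topspace ?Z. W p \<in> {..0}}"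
  \<comment> \<open>At height \<open>1/2\<close> only the sides belong to \<open>B\<close>, where both spheroids are constant.\<close>
  define a0 where "a0 p = (if fst p \<le> 1/2 then a (snd p) else a' (snd p))" for p :: "real \<times> (nat \<Rightarrow> real)"
  have fstZ: "fst p \<in> {0..1}" and sndZ: "snd p \<in> topspace (cube q)" if "p \<in> topspace ?Z" for p
    using that by (simp_all add: mem_Times_iff)
  have B_iff: "p \<in> B \<longleftrightarrow> fst p \<in> {0..1} \<and> snd p \<in> topspace (cube q) \<and>
      (fst p = 0 \<or> fst p = 1 \<or> snd p \<in> cube_boundary q)" for p
  proof -
    have "depth (fst p) \<le> 0 \<longleftrightarrow> fst p = 0 \<or> fst p = 1" if "fst p \<in> {0..1}"
      using depth_le_0[OF that] depth_eq_0 by auto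
    then show ?thesis
      using cube_boundary_iff_depth[of "snd p" q]
      by (auto simp: B_def W_def mem_Times_iff min_le_iff_disj)
  qed
  have W: "continuous_map ?Z euclideanreal W"
  proof -
    have "continuous_map ?Z euclideanreal (\<lambda>p. cube_depth q (snd p))"
      using continuous_map_compose[OF continuous_map_snd continuous_map_cube_depth] by (simp add: o_def)
    then show ?thesis
      unfolding W_def depth_def by (intro continuous_intros continuous_map_unit_coordinate)
  qed
  have Wnn: "0 \<le> W p" if "p \<in> topspace ?Z" for p
    using depth_nonneg[OF fstZ[OF that]] cube_depth_nonneg[OF sndZ[OF that]] by (simp add: W_def)
  have B: "closedin ?Z B"
    unfolding B_def by (rule closedin_continuous_map_preimage[OF W]) simp
  have \<rho>: "continuous_map ?Z ?Z \<rho>"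
    unfolding \<rho>_def
  proof (intro continuous_map_pairedI continuous_map_into_subtopology)
    show "continuous_map ?Z euclidean (\<lambda>p. squash (fst p))"
      unfolding squash_def by (intro continuous_intros continuous_map_unit_coordinate)
    show "(\<lambda>p. squash (fst p)) \<in> topspace ?Z \<rightarrow> {0..1}" using squash_in_unit by blast
    show "continuous_map ?Z (cube q) (\<lambda>p. cube_squash q (snd p))"
      using continuous_map_compose[OF continuous_map_snd continuous_map_cube_squash] by (simp add: o_def)
  qed
  have \<rho>Z: "\<rho> p \<in> topspace ?Z" if "p \<in> topspace ?Z" for p
    using continuous_map_image_subset_topspace[OF \<rho>] that by blast
  have \<rho>B: "\<rho> p \<in> B" if p: "p \<in> topspace ?Z" "W p \<le> 1" for p
  proof -
    have "depth (fst p) \<le> 1 \<or> cube_depth q (snd p) \<le> 1" using p(2) by (simp add: W_def min_le_iff_disj)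
    then have "squash (fst p) = 0 \<or> squash (fst p) = 1 \<or> cube_squash q (snd p) \<in> cube_boundary q"
      using depth_le_1 cube_squash_in_boundary by blast
    then show ?thesis
      using fstZ[OF \<rho>Z[OF p(1)]] sndZ[OF \<rho>Z[OF p(1)]] unfolding B_iff by (simp add: \<rho>_def)
  qed
  have a0: "continuous_map (subtopology ?Z B) ?X a0"
    unfolding a0_def
  proof (rule continuous_map_cases_le)
    show "continuous_map (subtopology ?Z B) euclideanreal (\<lambda>p. fst p)"
      by (rule continuous_map_from_subtopology[OF continuous_map_unit_coordinate])
    have as: "continuous_map ?Z ?X (\<lambda>p. a (snd p))" and as': "continuous_map ?Z ?X (\<lambda>p. a' (snd p))"
      using continuous_map_compose[OF continuous_map_snd a1(1)]
        continuous_map_compose[OF continuous_map_snd a2(1)] by (simp_all add: o_def)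
    show "continuous_map (subtopology (subtopology ?Z B) {p \<in> topspace (subtopology ?Z B). fst p \<le> 1/2})
          ?X (\<lambda>p. a (snd p))"
      by (intro continuous_map_from_subtopology as)
    show "continuous_map (subtopology (subtopology ?Z B) {p \<in> topspace (subtopology ?Z B). 1/2 \<le> fst p})
          ?X (\<lambda>p. a' (snd p))"
      by (intro continuous_map_from_subtopology as')
    show "a (snd p) = a' (snd p)" if "p \<in> topspace (subtopology ?Z B)" "fst p = 1/2" for p
    proof -
      have "p \<in> B" using that(1) by (simp add: topspace_subtopology)
      then have "snd p \<in> cube_boundary q" using that(2) unfolding B_iff by simp
      then show ?thesis using a1(2) a2(2) by simp
    qed
  qed simp
  have ev_a0: "ev k (a0 p) = h p" if "p \<in> B" for p
  proof -
    have p: "fst p \<in> {0..1}" "snd p \<in> topspace (cube q)"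
      "fst p = 0 \<or> fst p = 1 \<or> snd p \<in> cube_boundary q"
      using that unfolding B_iff by simp_all
    from p(3) consider "fst p = 0" | "fst p = 1" | "snd p \<in> cube_boundary q" by blast
    then show ?thesis
    proof cases
      case 1
      then show ?thesis using h(2)[OF p(2)] by (cases p) (simp add: a0_def)
    next
      case 2
      then show ?thesis using h(3)[OF p(2)] by (cases p) (simp add: a0_def)
    next
      case 3
      then show ?thesis using h(4)[OF p(1) 3] a1(2)[OF 3] a2(2)[OF 3] by (simp add: a0_def)
    qed
  qed
  have Zc: "compact_space ?Z"
    by (simp add: compact_space_prod_topology compact_space_cube compact_space_subtopology)
  obtain A \<nu> where A: "continuous_map ?Z ?X A"
    and A0: "\<And>p. p \<in> topspace ?Z \<Longrightarrow> W p = 0 \<Longrightarrow> A p = a0 (\<rho> p)"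
    using lift_along_collar[OF r Zc B h(1) a0 ev_a0 \<rho> W Wnn \<rho>B] by metis
  have W0: "W p = 0" if "p \<in> B" for p
    using that Wnn[of p] by (auto simp: B_def)
  have A_bdry: "A p = a0 (\<rho> p)" if "p \<in> B" for p
    using A0[OF _ W0[OF that]] that by (simp add: B_def)
  have "(a \<circ> cube_squash q, a' \<circ> cube_squash q) \<in> spheroid_homotopy q ?X x"
    unfolding spheroid_homotopy_iff
  proof (intro exI[of _ A] conjI ballI)
    show "continuous_map ?Z ?X A" by (rule A)
    fix t assume t: "t \<in> topspace (cube q)"
    have "(0, t) \<in> B" "(1, t) \<in> B" using t unfolding B_iff by simp_all
    from A_bdry[OF this(1)] A_bdry[OF this(2)]
    show "A (0, t) = (a \<circ> cube_squash q) t" "A (1, t) = (a' \<circ> cube_squash q) t"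
      by (simp_all add: a0_def \<rho>_def squash_0 squash_1)
  next
    fix u :: real and t assume u: "u \<in> {0..1}" and t: "t \<in> cube_boundary q"
    have "(u, t) \<in> B" using u t unfolding B_iff by (simp add: cube_boundary_def)
    moreover have "cube_squash q t \<in> cube_boundary q"
      using cube_mix_boundary[of 0 t q] t by (simp add: cube_mix_0)
    ultimately show "A (u, t) = x"
      using A_bdry[of "(u, t)"] a1(2) a2(2) by (simp add: a0_def \<rho>_def)
  qed
  then show ?thesis
    using spheroid_homotopy_trans[OF spheroid_homotopy_sym[OF spheroid_homotopy_squash[OF a]]]
      spheroid_homotopy_trans[OF _ spheroid_homotopy_squash[OF a']] by blast
qed

text \<open>
  The lifting property for a one-point space with empty boundary.
\<close>

lemma lift_point:
  assumes r: "0 < r" and y: "y \<in> topspace (target r k)"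
  shows "\<exists>x\<in>topspace (rImm r k :: (nat \<times> 'a::fin_dim_inner \<Rightarrow> 'b::real_normed_vector) topology).
    path_component_of (target r k) (ev k x) y"
proof -
  let ?X = "rImm r k :: (nat \<times> 'a \<Rightarrow> 'b) topology"
  let ?Y = "target r k :: ((nat \<Rightarrow> 'b) \<times> (nat \<Rightarrow> 'a \<Rightarrow>\<^sub>L 'b)) topology"
  let ?Z = "top_of_set {0::real}"
  obtain a \<nu> where a: "continuous_map ?Z ?X a" and \<nu>: "0 < \<nu> (0::real)"
    and ev: "ev k (a 0) = scale_target k (\<nu> 0) y"
  proof (rule lift_along_collar[of r ?Z "{}" k "\<lambda>_. y" "\<lambda>_. undefined" id "\<lambda>_. 2"])
    show "compact_space ?Z" by (simp add: compact_space_subtopology)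
  qed (use r y in auto)
  have "path_component_of ?Y (scale_target k (\<nu> 0) y) y"
    unfolding path_component_of_def pathin_def
  proof (intro exI[of _ "\<lambda>u. scale_target k ((1 - u) * \<nu> 0 + u) y"] conjI)
    have const: "continuous_map (top_of_set {0..1::real}) ?Y (\<lambda>_. y)"
      using y unfolding continuous_map_const by (rule disjI2)
    have "continuous_map (top_of_set {0..1}) euclideanreal (\<lambda>u. (1 - u) * \<nu> 0 + u)"
      by (simp add: continuous_intros)
    moreover have "(1 - u) * \<nu> 0 + u \<noteq> 0" if "u \<in> topspace (top_of_set {0..1::real})" for u
      using mix_positive[of u "\<nu> 0"] \<nu> that by simp
    ultimately show "continuous_map (top_of_set {0..1}) ?Y (\<lambda>u. scale_target k ((1 - u) * \<nu> 0 + u) y)"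
      by (rule continuous_map_scale_target[OF _ _ const])
    show "scale_target k ((1 - 1) * \<nu> 0 + 1) y = y" using scale_target_1[OF y] by simp
  qed simp
  moreover have "a 0 \<in> topspace ?X"
    using continuous_map_image_subset_topspace[OF a] by auto
  ultimately show ?thesis using ev by metis
qed

text \<open>
  The lifting property for the interval, with the two given maps over its end points.
\<close>

lemma lift_path:
  fixes x x' :: "nat \<times> 'a::fin_dim_inner \<Rightarrow> 'b::real_normed_vector"
  assumes r: "0 < r" and x: "x \<in> topspace (rImm r k)" and x': "x' \<in> topspace (rImm r k)"
    and path: "path_component_of (target r k) (ev k x) (ev k x')"
  shows "path_component_of (rImm r k) x x'"
proof -
  let ?X = "rImm r k :: (nat \<times> 'a \<Rightarrow> 'b) topology"
  let ?Z = "top_of_set {0..1::real}"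
  obtain g where g: "continuous_map ?Z (target r k) g" "g 0 = ev k x" "g 1 = ev k x'"
    using path unfolding path_component_of_def pathin_def by blast
  define a0 where "a0 u = (if u \<le> 1/2 then x else x')" for u :: real
  have Z: "compact_space ?Z" by (simp add: compact_space_subtopology)
  have B: "closedin ?Z {0, 1}" by (auto intro!: closed_subset)
  have a0: "continuous_map (subtopology ?Z {0, 1}) ?X a0"
    unfolding a0_def
  proof (rule continuous_map_cases_le)
    show "x = x'" if "u \<in> topspace (subtopology ?Z {0, 1})" "u = 1/2" for u
      using that by auto
    show "continuous_map (subtopology ?Z {0, 1}) euclideanreal (\<lambda>u. u)"
      by (simp add: subtopology_subtopology)
  qed (use x x' in auto)
  have ev_a0: "ev k (a0 u) = g u" if "u \<in> {0, 1}" for u using that g by (auto simp: a0_def)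
  have "continuous_map ?Z euclideanreal squash"
    unfolding squash_def[abs_def] by (simp add: continuous_intros)
  then have squash: "continuous_map ?Z ?Z squash"
    using squash_in_unit by (auto intro: continuous_map_into_subtopology)
  have depth: "continuous_map ?Z euclideanreal depth"
    unfolding depth_def[abs_def] by (simp add: continuous_intros)
  have nonneg: "0 \<le> depth u" if "u \<in> topspace ?Z" for u using depth_nonneg that by simp
  have collar: "squash u \<in> {0, 1}" if "u \<in> topspace ?Z" "depth u \<le> 1" for u
    using depth_le_1[OF that(2)] by simp
  obtain A where A: "continuous_map ?Z ?X A"
    and A0: "\<And>u. u \<in> topspace ?Z \<Longrightarrow> depth u = 0 \<Longrightarrow> A u = a0 (squash u)"
    using lift_along_collar[OF r Z B g(1) a0 ev_a0 squash depth nonneg collar] by metis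
  show ?thesis
    unfolding path_component_of_def pathin_def
    using A A0[of 0] A0[of 1] by (intro exI[of _ A]) (simp add: depth_eq_0 squash_0 squash_1 a0_def)
qed

theorem theorem2p1:
  fixes r k :: nat
  assumes "r > 1" and "k \<ge> 1"
  shows "weak_homotopy_equivalence
    (rImm r k :: (nat \<times> 'a::fin_dim_inner \<Rightarrow> 'b::fin_dim_inner) topology)
    (prod_topology (rConf r k) (product_topology (\<lambda>_. Linj) {1..k}))
    (ev k)"
  unfolding weak_homotopy_equivalence_def
proof (intro conjI allI impI ballI)
  have r: "0 < r" using assms by simp
  show cont: "continuous_map (rImm r k :: (nat \<times> 'a \<Rightarrow> 'b) topology) (target r k) (ev k)"
    by (rule continuous_map_ev[OF r])
  show "bij_betw (path_components_map (target r k) (ev k))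
      (path_components_of (rImm r k :: (nat \<times> 'a \<Rightarrow> 'b) topology)) (path_components_of (target r k))"
    by (rule bij_betw_path_components_map[OF cont lift_point[OF r] lift_path[OF r]])
  show "bij_betw (homotopy_group_map q (target r k) (ev k x) (ev k))
      (homotopy_group q (rImm r k) x) (homotopy_group q (target r k) (ev k x))"
    if "x \<in> topspace (rImm r k :: (nat \<times> 'a \<Rightarrow> 'b) topology)" for q x
    by (rule bij_betw_homotopy_group_map[OF cont lift_spheroid[OF r that] lift_spheroid_homotopy[OF r]])
qed

end
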